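(* Consider the family of holomorphic two-forms $$\Omega=\frac{dt_1\wedge dt_2}{\sqrt{t_1t_2(1-t_1)(1-t_2)\,(1-z_1t_1-(1-z_2)t_2)}},$$ with parameters $(x,y)=(z_1,1-z_2)\in\mathbb{C}^2$. Its Picard--Fuchs system is the Appell $F_2$ system with $\alpha=\beta_1=\beta_2=\tfrac12$, $\gamma_1=\gamma_2=1$, i.e. the system (S) written out in the context. Let $U\subset\mathbb{C}^2$ be a connected open neighborhood of $(x,y)=(0,0)$ on which there are holomorphic functions $\Lambda_1,\Lambda_2$ with $\Lambda_1(0,0)=0$, $\Lambda_2(0,0)=1$, $$x=\frac{4\Lambda_1\Lambda_2}{(\Lambda_1+\Lambda_2)^2},\qquad y=-\frac{(1-\Lambda_1^2)(1-\Lambda_2^2)}{(\Lambda_1+\Lambda_2)^2},$$ and $|\Lambda_1^2|<1$, $|1-\Lambda_2^2|<1$ on $U$. Then the functions $$\begin{aligned} \Pi_0(x,y)&=\frac{4}{\pi^2}(\Lambda_1+\Lambda_2)\,K(\Lambda_1^2)\,K(1-\Lambda_2^2),\\ \Pi_1(x,y)&=\frac{4i}{\pi^2}(\Lambda_1+\Lambda_2)\,K(1-\Lambda_1^2)\,K(1-\Lambda_2^2),\\ \Pi_2(x,y)&=\frac{4i}{\pi^2}(\Lambda_1+\Lambda_2)\,K(\Lambda_1^2)\,K(\Lambda_2^2),\\ \Pi_3(x,y)&=\frac{4i^2}{\pi^2}(\Lambda_1+\Lambda_2)\,K(1-\Lambda_1^2)\,K(\Lambda_2^2) \end{aligned}$$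 form a basis of (multivalued) solutions of this system on $U\setminus\{xy=0\}$. That is, on every nonempty simply connected open subset $V\subset U\setminus\{xy=0\}$, with branches as specified in the context, $\Pi_0,\Pi_1,\Pi_2,\Pi_3$ are a basis of the complex vector space of holomorphic solutions of (S) on $V$.
   Context: $K$ is the complete elliptic integral of the first kind as a function of the parameter (not the modulus): $K(m)=\int_0^1\frac{dt}{\sqrt{(1-t^2)(1-mt^2)}}=\frac{\pi}{2}\,{}_2F_1(\tfrac12,\tfrac12;1;m)$, holomorphic on $|m|<1$. The system (S), for a holomorphic function $F(x,y)$, is $$x(1-x)\frac{\partial^2F}{\partial x^2}-xy\frac{\partial^2F}{\partial x\partial y}+(1-2x)\frac{\partial F}{\partial x}-\tfrac12\,y\frac{\partial F}{\partial y}-\tfrac14F=0,$$ $$y(1-y)\frac{\partial^2F}{\partial y^2}-xy\frac{\partial^2F}{\partial x\partial y}+(1-2y)\frac{\partial F}{\partial y}-\tfrac12\,x\frac{\partial F}{\partial x}-\tfrac14F=0.$$ Branches. In $K(\Lambda_1^2)$ and $K(1-\Lambda_2^2)$ the arguments lie in the open unit disc, and the values there are given by the power series of $K$. On $V$, $K(1-\Lambda_1^2)$ denotes any fixed holomorphic branch obtained by analytic continuation of $s\mapsto K(1-s^2)$ from $s\in(0,1)$ along paths in $\{0<|s|<1\}$, evaluated at $s=\Lambda_1$. Similarly, $K(\Lambda_2^2)$ denotes any fixed holomorphic branch obtained by analytic continuation of $w\mapsto K(1-w)$ from $w\in(0,1)$ along paths in $\{0<|w|<1\}$, evaluated at $w=1-\Lambda_2^2$.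 The same branch is used in all four functions. *)

theory Defs
  imports "HOL-Analysis.Analysis"
begin

section \<open>The complete elliptic integral\<close>

text \<open>
  Function of the parameter \<open>m\<close>, not of the modulus. For \<open>norm m < 1\<close> the radicand is a
  nonnegative real times a number of positive real part, so the principal root is the
  continuous branch that is positive for real \<open>m\<close>. The value at the end point \<open>t = 1\<close>
  is the junk value \<open>1 / 0 = 0\<close> and does not affect the integral.
\<close>

definition ellK :: "complex \<Rightarrow> complex" where
  "ellK m = integral {0..1}
     (\<lambda>t::real. 1 / csqrt ((1 - (of_real t)\<^sup>2) * (1 - m * (of_real t)\<^sup>2)))"

lemma elliptic_moment:
  "((\<lambda>t. t ^ (2*n) / sqrt (1 - t\<^sup>2)) has_integral
      (pi/2 * (pochhammer (1/2) n / fact n))) {0..1::real}"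
proof (induction n)
  case 0
  have "((\<lambda>t. inverse (sqrt (1 - t\<^sup>2))) has_integral (arcsin 1 - arcsin 0)) {0..1::real}"
    by (rule fundamental_theorem_of_calculus_interior)
       (auto intro!: continuous_on_arcsin' continuous_intros
          simp flip: has_real_derivative_iff_has_vector_derivative intro!: DERIV_arcsin)
  then show ?case by (simp add: field_simps)
next
  case (Suc n)
  let ?F = "\<lambda>t::real. t ^ (2*n+1) * sqrt (1 - t\<^sup>2)"
  let ?f = "\<lambda>t::real. (2*n+1) * (t ^ (2*n) / sqrt (1 - t\<^sup>2)) - (2*n+2) * (t ^ (2 * Suc n) / sqrt (1 - t\<^sup>2))"
  have F: "(?f has_integral (?F 1 - ?F 0)) {0..1}"
  proof (rule fundamental_theorem_of_calculus_interior)
    fix t :: real assume t: "t \<in> {0<..<1}"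
    then have p: "1 - t\<^sup>2 > 0" by (simp add: power_less_one_iff)
    define s where "s = sqrt (1 - t\<^sup>2)"
    have s: "s > 0" "s * s = 1 - t\<^sup>2" using p by (simp_all add: s_def)
    have "((\<lambda>t. t ^ (2*n+1)) has_real_derivative (2*n+1) * t^(2*n)) (at t)"
      using DERIV_pow[of "2*n+1" t] by simp
    moreover have "((\<lambda>t. sqrt (1 - t\<^sup>2)) has_real_derivative (- (2 * t) * (inverse s / 2))) (at t)"
      unfolding s_def using p by (auto intro!: derivative_eq_intros)
    ultimately have "(?F has_real_derivative
        ((2*n+1) * t^(2*n) * sqrt (1 - t\<^sup>2) + - (2 * t) * (inverse s / 2) * t^(2*n+1))) (at t)"
      by (rule DERIV_mult)
    then have "(?F has_real_derivative
        ((2*n+1) * t^(2*n) * s + t^(2*n+1) * (- (2 * t) * (inverse s / 2)))) (at t)"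
      unfolding s_def[symmetric] by (simp only: mult.commute)
    moreover have "(2*n+1) * t^(2*n) * s + t^(2*n+1) * (- (2 * t) * (inverse s / 2)) = ?f t"
    proof -
      have "s * ((2*n+1) * t^(2*n) * s + t^(2*n+1) * (- (2 * t) * (inverse s / 2)))
          = (2*n+1) * t^(2*n) * (s * s) - t^(2*n+2)"
        using s(1) by (simp add: field_simps)
      also have "\<dots> = (2*n+1) * t^(2*n) - (2*n+2) * t^(2*n+2)"
        unfolding s(2) by (simp add: field_simps power2_eq_square)
      also have "\<dots> = s * ?f t"
        unfolding s_def[symmetric] using s(1) by (simp add: field_simps)
      finally show ?thesis using s(1) by simp
    qed
    ultimately show "(?F has_vector_derivative ?f t) (at t)"
      by (simp add: has_real_derivative_iff_has_vector_derivative)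
  qed (auto intro!: continuous_intros)
  have "((\<lambda>t. ((2*n+1) * (t ^ (2*n) / sqrt (1 - t\<^sup>2)) - ?f t) / (2*n+2)) has_integral
      ((2*n+1) * (pi/2 * (pochhammer (1/2) n / fact n)) - (?F 1 - ?F 0)) / (2*n+2)) {0..1}"
    by (intro has_integral_divide has_integral_diff has_integral_mult_right Suc F)
  moreover have "((2*n+1) * (pi/2 * (pochhammer (1/2) n / fact n)) - (?F 1 - ?F 0)) / (2*n+2)
      = pi/2 * (pochhammer (1/2) (Suc n) / fact (Suc n))"
  proof -
    have "(2*n+1) / (2*n+2) = ((1/2 + real n) / (1 + real n))"
      by (simp add: field_simps)
    then show ?thesis by (simp add: pochhammer_rec' divide_simps)
  qed
  moreover have "((2*n+1) * (t ^ (2*n) / sqrt (1 - t\<^sup>2)) - ?f t) / (2*n+2) = t ^ (2 * Suc n) / sqrt (1 - t\<^sup>2)" for t :: real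
    by (simp del: power_Suc)
  ultimately show ?case by (simp only:)
qed

text \<open>The integral is given by its hypergeometric power series on the unit disc.\<close>

lemma ellK_sums:
  assumes m: "norm m < 1"
  shows "(\<lambda>n. of_real (pi/2) * (pochhammer (1/2) n / fact n)\<^sup>2 * m ^ n) sums ellK m"
proof -
  define a :: "nat \<Rightarrow> real" where "a n = pochhammer (1/2) n / fact n" for n
  have a01: "0 \<le> a n \<and> a n \<le> 1" for n
  proof (induction n)
    case (Suc n)
    have "a (Suc n) = a n * ((1/2 + real n) / (1 + real n))"
      by (simp add: a_def pochhammer_rec' divide_simps)
    moreover have "0 \<le> (1/2 + real n) / (1 + real n)" "(1/2 + real n) / (1 + real n) \<le> 1"
      by (simp_all add: divide_simps)
    ultimately show ?case using Suc by (metis mult_le_one mult_nonneg_nonneg)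
  qed (simp add: a_def)
  define w where "w t = 1 / sqrt (1 - t\<^sup>2)" for t :: real
  have W: "((\<lambda>t. t ^ (2*n) * w t) has_integral (pi/2 * a n)) {0..1}" for n
    using elliptic_moment[of n] by (simp add: w_def a_def)
  let ?g = "\<lambda>t::real. 1 / csqrt ((1 - (of_real t)\<^sup>2) * (1 - m * (of_real t)\<^sup>2))"
  let ?f = "\<lambda>N t. \<Sum>n<N. of_real (t ^ (2*n) * w t) * (of_real (a n) * m ^ n)"
  have fint: "(?f N has_integral (\<Sum>n<N. of_real (pi/2 * a n) * (of_real (a n) * m ^ n))) {0..1}" for N
    by (intro has_integral_sum has_integral_mult_left has_integral_of_real W) auto
  have hint: "(\<lambda>t. w t * (1 / (1 - norm m))) integrable_on {0..1}"
    using has_integral_mult_left[OF W[of 0], of "1 / (1 - norm m)"] by (auto simp: integrable_on_def)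
  have le: "norm (?f N t) \<le> w t * (1 / (1 - norm m))" if t: "t \<in> {0..1}" for N t
  proof -
    have w0: "w t \<ge> 0" using t by (simp add: w_def power_le_one)
    have "norm (?f N t) \<le> (\<Sum>n<N. w t * norm m ^ n)"
    proof (rule order_trans[OF norm_sum sum_mono])
      fix n
      have "t ^ (2*n) * a n \<le> 1" using t a01[of n] by (intro mult_le_one power_le_one) auto
      then have "(t ^ (2*n) * a n) * (w t * norm m ^ n) \<le> 1 * (w t * norm m ^ n)"
        using w0 by (intro mult_right_mono) auto
      then show "norm (of_real (t ^ (2*n) * w t) * (of_real (a n) * m ^ n)) \<le> w t * norm m ^ n"
        using t a01[of n] w0 by (simp add: norm_mult norm_power abs_mult mult_ac)
    qed
    also have "\<dots> = w t * (\<Sum>n<N. norm m ^ n)" by (simp add: sum_distrib_left)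
    also have "\<dots> \<le> w t * (1 / (1 - norm m))"
    proof (rule mult_left_mono[OF _ w0])
      have "(\<Sum>n<N. norm m ^ n) \<le> (\<Sum>n. norm m ^ n)"
        using m by (intro sum_le_suminf) (auto intro: summable_geometric)
      then show "(\<Sum>n<N. norm m ^ n) \<le> 1 / (1 - norm m)"
        using m by (simp add: suminf_geometric)
    qed
    finally show ?thesis .
  qed
  have conv: "(\<lambda>N. ?f N t) \<longlonglongrightarrow> ?g t" if t: "t \<in> {0..1}" for t
  proof (cases "t = 1")
    case True
    then show ?thesis by (simp add: w_def)
  next
    case False
    with t have t2: "0 \<le> t\<^sup>2" "t\<^sup>2 < 1" by (auto simp: power_less_one_iff)
    let ?z = "- (m * (of_real t)\<^sup>2) :: complex"
    have nz: "norm ?z < 1"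
    proof -
      have "norm m * t\<^sup>2 \<le> norm m * 1" using t2 by (intro mult_left_mono) auto
      with m show ?thesis by (simp add: norm_mult norm_power)
    qed
    then have re: "Re (1 + ?z) > 0" using abs_Re_le_cmod[of ?z] by simp
    have "csqrt ((1 - (of_real t)\<^sup>2) * (1 + ?z)) = csqrt (of_real (1 - t\<^sup>2)) * csqrt (1 + ?z)"
    proof -
      have "Arg (of_real (1 - t\<^sup>2)) = 0" using t2 by (intro Arg_of_real[THEN trans]) auto
      then have "csqrt (of_real (1 - t\<^sup>2) * (1 + ?z)) = csqrt (of_real (1 - t\<^sup>2)) * csqrt (1 + ?z)"
        using mpi_less_Arg[of "1 + ?z"] Arg_le_pi[of "1 + ?z"] by (intro csqrt_mult) auto
      then show ?thesis by simp
    qed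
    also have "csqrt (of_real (1 - t\<^sup>2)) = of_real (sqrt (1 - t\<^sup>2))"
      using t2 by (intro csqrt_of_real) auto
    finally have g: "?g t = of_real (w t) * (1 + ?z) powr (-1/2)"
      by (simp add: w_def csqrt_conv_powr powr_minus divide_simps)
    have "(\<lambda>n. ((-1/2) gchoose n) * ?z ^ n) sums (1 + ?z) powr (-1/2)"
      by (rule gen_binomial_complex[OF nz])
    then have "(\<lambda>n. of_real (w t) * (((-1/2) gchoose n) * ?z ^ n)) sums ?g t"
      unfolding g by (rule sums_mult)
    moreover have "of_real (w t) * (((-1/2) gchoose n) * ?z ^ n)
        = of_real (t ^ (2*n) * w t) * (of_real (a n) * m ^ n)" for n
    proof -
      have "((-1/2) gchoose n) * ?z ^ n = (-1)^n * of_real (a n) * ((-1)^n * (m * (of_real t)\<^sup>2) ^ n)"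
        by (simp add: gbinomial_pochhammer a_def power_minus[of "m * _"] flip: pochhammer_of_real)
      also have "\<dots> = of_real (a n) * (m ^ n * of_real t ^ (2*n))"
        by (simp add: power_mult_distrib power_mult flip: power_add mult_2)
      finally show ?thesis by simp
    qed
    ultimately have "(\<lambda>n. of_real (t ^ (2*n) * w t) * (of_real (a n) * m ^ n)) sums ?g t"
      by (simp only:)
    then show ?thesis unfolding sums_def .
  qed
  have "(\<lambda>N. integral {0..1} (?f N)) \<longlonglongrightarrow> integral {0..1} ?g"
    by (rule dominated_convergence(2)[OF _ hint le conv]) (use fint in blast)
  then have "(\<lambda>n. of_real (pi/2 * a n) * (of_real (a n) * m ^ n)) sums ellK m"
    unfolding sums_def ellK_def integral_unique[OF fint] .
  moreover have "of_real (pi/2 * a n) * (of_real (a n) * m ^ n)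
      = of_real (pi/2) * (pochhammer (1/2) n / fact n)\<^sup>2 * m ^ n" for n
    by (simp add: a_def power2_eq_square mult_ac flip: pochhammer_of_real)
  ultimately show ?thesis by (simp only:)
qed


section \<open>Holomorphic functions of two variables and the Appell system\<close>

text \<open>Complex differentiability on \<open>\<complex>\<^sup>2\<close>: the real derivative exists and is complex linear.\<close>

definition holomorphic2_on :: "(complex \<times> complex \<Rightarrow> complex) \<Rightarrow> (complex \<times> complex) set \<Rightarrow> bool"
  (infixl "holomorphic2'_on" 50) where
  "F holomorphic2_on S \<longleftrightarrow>
     (\<forall>p\<in>S. \<exists>a b. (F has_derivative (\<lambda>(h, k). a * h + b * k)) (at p within S))"

definition pdx :: "(complex \<times> complex \<Rightarrow> complex) \<Rightarrow> complex \<times> complex \<Rightarrow> complex" where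
  "pdx F = (\<lambda>(x, y). deriv (\<lambda>s. F (s, y)) x)"

definition pdy :: "(complex \<times> complex \<Rightarrow> complex) \<Rightarrow> complex \<times> complex \<Rightarrow> complex" where
  "pdy F = (\<lambda>(x, y). deriv (\<lambda>s. F (x, s)) y)"

text \<open>The system of the Appell function \<open>F\<^sub>2(\<alpha>; \<beta>\<^sub>1, \<beta>\<^sub>2; \<gamma>\<^sub>1, \<gamma>\<^sub>2; x, y)\<close>.\<close>

definition appell_F2_system ::
  "complex \<Rightarrow> complex \<Rightarrow> complex \<Rightarrow> complex \<Rightarrow> complex \<Rightarrow>
     (complex \<times> complex \<Rightarrow> complex) \<Rightarrow> complex \<Rightarrow> complex \<Rightarrow> bool" where
  "appell_F2_system \<alpha> \<beta>\<^sub>1 \<beta>\<^sub>2 \<gamma>\<^sub>1 \<gamma>\<^sub>2 F x y \<longleftrightarrow>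
     x * (1 - x) * pdx (pdx F) (x, y) - x * y * pdx (pdy F) (x, y)
       + (\<gamma>\<^sub>1 - (\<alpha> + \<beta>\<^sub>1 + 1) * x) * pdx F (x, y) - \<beta>\<^sub>1 * y * pdy F (x, y)
       - \<alpha> * \<beta>\<^sub>1 * F (x, y) = 0 \<and>
     y * (1 - y) * pdy (pdy F) (x, y) - x * y * pdx (pdy F) (x, y)
       + (\<gamma>\<^sub>2 - (\<alpha> + \<beta>\<^sub>2 + 1) * y) * pdy F (x, y) - \<beta>\<^sub>2 * x * pdx F (x, y)
       - \<alpha> * \<beta>\<^sub>2 * F (x, y) = 0"

text \<open>
  The Picard--Fuchs system of the two-forms
  \<open>dt\<^sub>1 \<and> dt\<^sub>2 / \<surd>(t\<^sub>1 t\<^sub>2 (1 - t\<^sub>1) (1 - t\<^sub>2) (1 - x t\<^sub>1 - y t\<^sub>2))\<close>.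
\<close>

definition system_S :: "(complex \<times> complex \<Rightarrow> complex) \<Rightarrow> complex \<Rightarrow> complex \<Rightarrow> bool" where
  "system_S F x y \<longleftrightarrow>
     x * (1 - x) * pdx (pdx F) (x, y) - x * y * pdx (pdy F) (x, y)
       + (1 - 2 * x) * pdx F (x, y) - 1/2 * y * pdy F (x, y) - 1/4 * F (x, y) = 0 \<and>
     y * (1 - y) * pdy (pdy F) (x, y) - x * y * pdx (pdy F) (x, y)
       + (1 - 2 * y) * pdy F (x, y) - 1/2 * x * pdx F (x, y) - 1/4 * F (x, y) = 0"

lemma system_S_eq_appell: "system_S F x y \<longleftrightarrow> appell_F2_system (1/2) (1/2) (1/2) 1 1 F x y"
  by (simp add: system_S_def appell_F2_system_def)

text \<open>
  Holomorphic solutions on an open set \<open>V\<close>. Functions are total in HOL; their values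
  off \<open>V\<close> play no role, and equality of solutions means equality on \<open>V\<close>.
\<close>

definition solutions_on :: "(complex \<times> complex) set \<Rightarrow> (complex \<times> complex \<Rightarrow> complex) set" where
  "solutions_on V = {F. F holomorphic2_on V \<and> (\<forall>(x, y)\<in>V. system_S F x y)}"

definition solution_basis_on ::
  "(complex \<times> complex) set \<Rightarrow> (complex \<times> complex \<Rightarrow> complex) list \<Rightarrow> bool" where
  "solution_basis_on V Fs \<longleftrightarrow>
     set Fs \<subseteq> solutions_on V \<and>
     (\<forall>c :: nat \<Rightarrow> complex. (\<forall>p\<in>V. (\<Sum>i<length Fs. c i * (Fs ! i) p) = 0)
        \<longrightarrow> (\<forall>i<length Fs. c i = 0)) \<and>
     (\<forall>F\<in>solutions_on V. \<exists>c :: nat \<Rightarrow> complex.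
        \<forall>p\<in>V. F p = (\<Sum>i<length Fs. c i * (Fs ! i) p))"


section \<open>Analytic continuation along paths\<close>

text \<open>
  \<open>h t\<close> represents the germ at \<open>\<gamma> t\<close>. The second condition says that for \<open>u\<close> near \<open>t\<close>
  the germ at \<open>\<gamma> u\<close> is the one induced by \<open>h t\<close>.
\<close>

definition continues_along ::
  "(real \<Rightarrow> complex) \<Rightarrow> (complex \<Rightarrow> complex) \<Rightarrow> (complex \<Rightarrow> complex) \<Rightarrow> bool" where
  "continues_along \<gamma> f g \<longleftrightarrow> path \<gamma> \<and>
     (\<exists>h :: real \<Rightarrow> complex \<Rightarrow> complex.
        (\<forall>t\<in>{0..1}. h t analytic_on {\<gamma> t}) \<and>
        (\<forall>t\<in>{0..1}. \<forall>\<^sub>F u in at t within {0..1}. \<forall>\<^sub>F z in nhds (\<gamma> u). h u z = h t z) \<and>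
        (\<forall>\<^sub>F z in nhds (pathstart \<gamma>). h 0 z = f z) \<and>
        (\<forall>\<^sub>F z in nhds (pathfinish \<gamma>). h 1 z = g z))"

text \<open>
  \<open>B\<close> is a holomorphic branch on \<open>V\<close> of the multivalued function \<open>p \<mapsto> f (\<phi> p)\<close>, where
  \<open>f\<close>, given near the interval \<open>(0,1)\<close>, is continued along paths in the punctured unit disc
  that start on this interval.
\<close>

definition branch_on ::
  "(complex \<times> complex) set \<Rightarrow> (complex \<Rightarrow> complex) \<Rightarrow> (complex \<times> complex \<Rightarrow> complex) \<Rightarrow>
     (complex \<times> complex \<Rightarrow> complex) \<Rightarrow> bool" where
  "branch_on V f \<phi> B \<longleftrightarrow> B holomorphic2_on V \<and>
     (\<forall>p\<in>V. \<exists>\<gamma> g. pathstart \<gamma> \<in> of_real ` {0<..<1} \<and> pathfinish \<gamma> = \<phi> p \<and>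
        path_image \<gamma> \<subseteq> {s. 0 < norm s \<and> norm s < 1} \<and>
        continues_along \<gamma> f g \<and> (\<forall>\<^sub>F q in nhds p. B q = g (\<phi> q)))"

end

theory Submission
  imports Defs "HOL-Complex_Analysis.Complex_Analysis"
begin

text \<open>
  In the coordinates \<open>a = \<Lambda>\<^sub>1\<close>, \<open>b = \<Lambda>\<^sub>2\<close> the Appell system separates: for \<open>F = (a + b) G\<close> the two
  equations of (S) are, up to an invertible matrix of functions, the equations \<open>L\<^sub>a G = 0\<close> and
  \<open>L\<^sub>b G = 0\<close>, where \<open>L\<^sub>s = s (1 - s\<^sup>2) d\<^sup>2/ds\<^sup>2 + (1 - 3 s\<^sup>2) d/ds - s\<close> annihilates \<open>K(s\<^sup>2)\<close> and
  \<open>K(1 - s\<^sup>2)\<close>. The matrix is invertible exactly where the Jacobian of \<open>(a, b) \<mapsto> (x, y)\<close> does not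
  vanish, and it does not vanish on \<open>V\<close> because \<open>(\<Lambda>\<^sub>1, \<Lambda>\<^sub>2)\<close> is a holomorphic right inverse of that map.
  So locally the solutions are the tensor product of two planes of solutions of ordinary
  differential equations. The equations and the nonvanishing of the Wronskians survive analytic
  continuation along the paths that define the branches. The local coefficients of a solution
  are locally constant, hence constant on the connected set \<open>V\<close>.
\<close>

section \<open>Holomorphic functions of two variables\<close>

text \<open>The equation of \<open>K\<close> is taken in the self-adjoint form
  \<open>(p f')' - q f = 0\<close>, for which \<open>p\<close> times the Wronskian is constant.
  \<open>K\<close> is single-valued on the unit disc. Paired with it, every continuation of
  \<open>K(1 - m)\<close> keeps the same nonzero Wronskian: monodromy changes the branch, never its
  independence of \<open>K\<close>. The initial value is taken at \<open>m = 1/2\<close>, the fixed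
  point of \<open>m -> 1 - m\<close>. \<open>holomorphic2_on\<close> provides one complex
  derivative, whereas (S) has second derivatives and its change of coordinates needs equal mixed
  partials. Osgood's lemma and Cauchy's formula close this gap. The image of \<open>V\<close> in the
  coordinates \<open>(a, b)\<close> need not be a product, so variables are separated on small
  boxes. These exist because the coordinate map is continuous and injective, hence open by
  invariance of domain.\<close>

lemma open_prod_boxE:
  assumes "open S" "(x, y) \<in> S"
  obtains A B where "open A" "open B" "x \<in> A" "y \<in> B" "A \<times> B \<subseteq> S"
  using open_prod_elim[OF assms] by (metis SigmaD1 SigmaD2)

lemma holomorphic2_on_openD:
  assumes "F holomorphic2_on S" "open S" "(x, y) \<in> S"
  shows has_derivative_holomorphic2:
      "(F has_derivative (\<lambda>(h, k). pdx F (x, y) * h + pdy F (x, y) * k)) (at (x, y))"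
    and has_field_derivative_pdx:
      "((\<lambda>s. F (s, y)) has_field_derivative pdx F (x, y)) (at x)"
    and has_field_derivative_pdy:
      "((\<lambda>s. F (x, s)) has_field_derivative pdy F (x, y)) (at y)"
proof -
  obtain a b where ab: "(F has_derivative (\<lambda>(h, k). a * h + b * k)) (at (x, y))"
    using assms by (metis holomorphic2_on_def at_within_open)
  have "((\<lambda>s. (s, y)) has_derivative (\<lambda>h. (h, 0))) (at x)"
    by (auto intro!: derivative_eq_intros)
  from has_derivative_compose[OF this ab]
  have x: "((\<lambda>s. F (s, y)) has_field_derivative a) (at x)"
    by (simp add: has_field_derivative_def)
  have "((\<lambda>s. (x, s)) has_derivative (\<lambda>h. (0, h))) (at y)"
    by (auto intro!: derivative_eq_intros)
  from has_derivative_compose[OF this ab]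
  have y: "((\<lambda>s. F (x, s)) has_field_derivative b) (at y)"
    by (simp add: has_field_derivative_def)
  have "pdx F (x, y) = a" "pdy F (x, y) = b"
    using x y by (auto simp: pdx_def pdy_def intro: DERIV_imp_deriv)
  with ab x y show
    "(F has_derivative (\<lambda>(h, k). pdx F (x, y) * h + pdy F (x, y) * k)) (at (x, y))"
    "((\<lambda>s. F (s, y)) has_field_derivative pdx F (x, y)) (at x)"
    "((\<lambda>s. F (x, s)) has_field_derivative pdy F (x, y)) (at y)"
    by auto
qed

lemma holomorphic_slices:
  assumes "F holomorphic2_on S" "open S"
  shows holomorphic_on_slice_x: "(\<And>s. s \<in> A \<Longrightarrow> (s, y) \<in> S) \<Longrightarrow> (\<lambda>s. F (s, y)) holomorphic_on A"
    and holomorphic_on_slice_y: "(\<And>s. s \<in> A \<Longrightarrow> (x, s) \<in> S) \<Longrightarrow> (\<lambda>s. F (x, s)) holomorphic_on A"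
  using holomorphic2_on_openD(2,3)[OF assms]
  by (meson field_differentiable_at_within field_differentiable_def holomorphic_onI)+

lemma holomorphic2_on_imp_continuous_on:
  assumes "F holomorphic2_on S"
  shows "continuous_on S F"
  using assms unfolding holomorphic2_on_def continuous_on_eq_continuous_within
  by (meson has_derivative_continuous)

lemma holomorphic2_on_subset: "F holomorphic2_on S \<Longrightarrow> T \<subseteq> S \<Longrightarrow> F holomorphic2_on T"
  unfolding holomorphic2_on_def by (meson has_derivative_subset subsetD)

section \<open>Exchange of the two variables and holomorphy of the partial derivatives\<close>

lemma open_swap_image: "open (prod.swap ` S)" if "open (S :: (complex \<times> complex) set)"
proof -
  have "prod.swap ` S = prod.swap -` S"
    by force
  moreover have "continuous_on UNIV (prod.swap :: complex \<times> complex \<Rightarrow> _)"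
    by (intro continuous_on_swap)
  ultimately show ?thesis
    using that by (metis continuous_on_open_vimage open_UNIV Int_UNIV_right)
qed

lemma pdx_swap: "pdx (F \<circ> prod.swap) (x, y) = pdy F (y, x)"
  and pdy_swap: "pdy (F \<circ> prod.swap) (x, y) = pdx F (y, x)"
  by (simp_all add: pdx_def pdy_def)

lemma pdx_eq_swap: "pdx F = pdy (F \<circ> prod.swap) \<circ> prod.swap"
  by (auto simp: fun_eq_iff pdy_swap)

lemma holomorphic2_on_swap:
  assumes "F holomorphic2_on S"
  shows "(F \<circ> prod.swap) holomorphic2_on (prod.swap ` S)"
  unfolding holomorphic2_on_def
proof
  fix p assume "p \<in> prod.swap ` S"
  then obtain x y where xy: "(x, y) \<in> S" and p: "p = (y, x)"
    by auto
  then obtain a b where ab: "(F has_derivative (\<lambda>(h, k). a * h + b * k)) (at (x, y) within S)"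
    using assms by (auto simp: holomorphic2_on_def)
  have S: "prod.swap ` prod.swap ` S = S"
    by (auto simp: image_image)
  have "(prod.swap has_derivative (\<lambda>h. (snd h, fst h))) (at (y, x) within prod.swap ` S)"
    unfolding prod.swap_def by (auto intro!: derivative_eq_intros)
  from diff_chain_within[OF this, of F "\<lambda>(h, k). a * h + b * k"] ab
  have "(F \<circ> prod.swap has_derivative (\<lambda>(h, k). b * h + a * k)) (at (y, x) within prod.swap ` S)"
    by (simp add: S o_def case_prod_unfold add.commute)
  then show "\<exists>a b. (F \<circ> prod.swap has_derivative (\<lambda>(h, k). a * h + b * k))
      (at p within prod.swap ` S)"
    unfolding p by blast
qed

text \<open>Cauchy's estimate bounds the derivative of \<open>F (x, s) - F (x0, s)\<close> in
  \<open>s\<close> by the supremum of this difference on a disc, and the supremum is small by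
  uniform continuity on a compact bidisc.\<close>

lemma continuous_on_pdy:
  assumes S: "open S" and F: "continuous_on S F"
    and hol: "\<And>x y. (x, y) \<in> S \<Longrightarrow> (\<lambda>s. F (x, s)) field_differentiable at y"
  shows "continuous_on S (pdy F)"
proof (rule continuous_at_imp_continuous_on, safe)
  fix x0 y0 assume p: "(x0, y0) \<in> S"
  obtain A B where AB: "open A" "open B" "x0 \<in> A" "y0 \<in> B" "A \<times> B \<subseteq> S"
    by (rule open_prod_boxE[OF S p])
  obtain r1 where r1: "r1 > 0" "cball x0 r1 \<subseteq> A"
    using AB open_contains_cball_eq by blast
  obtain r2 where r2: "r2 > 0" "cball y0 r2 \<subseteq> B"
    using AB open_contains_cball_eq by blast
  \<comment> \<open>Half the radius: for \<open>y\<close> within \<open>r\<close> of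
    \<open>y0\<close>, the closed disc of radius \<open>r\<close> about \<open>y\<close> stays in
    \<open>cball y0 r2\<close>.\<close>
  define r where "r = r2 / 2"
  have r: "r > 0" "r2 = 2 * r" using r2 by (simp_all add: r_def)
  define T where "T = cball x0 r1 \<times> cball y0 r2"
  have TS: "T \<subseteq> S" using AB r1 r2 by (auto simp: T_def)
  have uc: "uniformly_continuous_on T F"
    unfolding T_def using TS[unfolded T_def]
    by (intro compact_uniformly_continuous compact_Times compact_cball continuous_on_subset[OF F])
  have hol': "(\<lambda>s. F (x, s)) holomorphic_on cball y0 r2" if "x \<in> cball x0 r1" for x
    unfolding holomorphic_on_def
  proof
    fix y assume "y \<in> cball y0 r2"
    then have "(x, y) \<in> S" using TS that by (auto simp: T_def)
    from hol[OF this] show "(\<lambda>s. F (x, s)) field_differentiable at y within cball y0 r2"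
      by (rule field_differentiable_at_within)
  qed
  show "isCont (pdy F) (x0, y0)"
    unfolding continuous_at_eps_delta
  proof (intro allI impI)
    fix e :: real assume e: "e > 0"
    \<comment> \<open>Makes Cauchy's bound \<open>e' / r\<close> equal to \<open>e / 2\<close>. The
      other half pays for moving \<open>y\<close> to \<open>y0\<close> with \<open>x0\<close>
      fixed.\<close>
    define e' where "e' = e / 2 * r"
    have e': "e' > 0" using e r by (simp add: e'_def)
    obtain d1 where d1: "d1 > 0"
      "\<And>p p'. p \<in> T \<Longrightarrow> p' \<in> T \<Longrightarrow> dist p' p < d1 \<Longrightarrow> dist (F p') (F p) < e'"
      using uc e' unfolding uniformly_continuous_on_def by metis
    have "isCont (deriv (\<lambda>s. F (x0, s))) y0"
    proof -
      have "(\<lambda>s. F (x0, s)) holomorphic_on ball y0 r2"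
        using hol'[of x0] r1 by (auto intro: holomorphic_on_subset)
      then have "deriv (\<lambda>s. F (x0, s)) holomorphic_on ball y0 r2"
        by (rule holomorphic_deriv) simp
      then have "continuous_on (ball y0 r2) (deriv (\<lambda>s. F (x0, s)))"
        by (rule holomorphic_on_imp_continuous_on)
      then show ?thesis using r2
        by (simp add: continuous_on_eq_continuous_at)
    qed
    then obtain d2 where d2: "d2 > 0"
      "\<And>y. dist y y0 < d2 \<Longrightarrow> dist (deriv (\<lambda>s. F (x0, s)) y) (deriv (\<lambda>s. F (x0, s)) y0) < e / 2"
      using e unfolding continuous_at_eps_delta by (metis half_gt_zero)
    define d where "d = Min {d1, d2, r1, r}"
    have d: "d > 0" "d \<le> d1" "d \<le> d2" "d \<le> r1" "d \<le> r"
      using d1 d2 r1 r by (auto simp: d_def)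
    show "\<exists>d>0. \<forall>p'. dist p' (x0, y0) < d \<longrightarrow> dist (pdy F p') (pdy F (x0, y0)) < e"
    proof (intro exI conjI allI impI)
      fix p' assume p': "dist p' (x0, y0) < d"
      obtain x y where xy: "p' = (x, y)" by (cases p')
      have dx: "dist x x0 < d" using p' dist_fst_le[of p' "(x0,y0)"] by (simp add: xy)
      have dy: "dist y y0 < d" using p' dist_snd_le[of p' "(x0,y0)"] by (simp add: xy)
      have xin: "x \<in> cball x0 r1" "x0 \<in> cball x0 r1" using dx d r1 by (auto simp: dist_commute)
      have sub: "cball y r \<subseteq> cball y0 r2"
      proof
        fix z assume "z \<in> cball y r"
        then show "z \<in> cball y0 r2"
          using dist_triangle[of y0 z y] dy d r by (simp add: dist_commute)
      qed
      let ?h = "\<lambda>s. F (x, s) - F (x0, s)"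
      have hh: "?h holomorphic_on cball y r"
        using sub xin by (intro holomorphic_intros holomorphic_on_subset[OF hol']) auto
      have "cmod ((deriv ^^ 1) ?h y) \<le> fact 1 * e' / r ^ 1"
      proof (rule Cauchy_higher_deriv_bound)
        show "?h holomorphic_on ball y r" using hh by (rule holomorphic_on_subset) auto
        show "continuous_on (cball y r) ?h" using hh by (rule holomorphic_on_imp_continuous_on)
        fix w assume "w \<in> ball y r"
        then have "w \<in> cball y0 r2" using sub ball_subset_cball by blast
        then have "dist (F (x, w)) (F (x0, w)) < e'"
          using xin dx d by (intro d1) (auto simp: T_def dist_prod_def)
        then show "?h w \<in> ball 0 e'" by (simp add: dist_norm norm_minus_commute)
      qed (use r in auto)
      moreover have "deriv ?h y = pdy F (x, y) - deriv (\<lambda>s. F (x0, s)) y"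
      proof -
        have "y \<in> cball y0 r2" using r sub by (meson centre_in_cball less_imp_le subsetD)
        then have "(x, y) \<in> S" "(x0, y) \<in> S" using TS xin unfolding T_def by blast+
        then show ?thesis
          by (subst deriv_diff) (auto simp: pdy_def intro: hol)
      qed
      ultimately have "dist (pdy F (x, y)) (deriv (\<lambda>s. F (x0, s)) y) \<le> e / 2"
        using r by (simp add: e'_def dist_norm)
      moreover have "dist (deriv (\<lambda>s. F (x0, s)) y) (pdy F (x0, y0)) < e / 2"
        using d2(2)[of y] dy d by (simp add: pdy_def)
      ultimately show "dist (pdy F p') (pdy F (x0, y0)) < e"
        using dist_triangle[of "pdy F (x, y)" "pdy F (x0, y0)" "deriv (\<lambda>s. F (x0, s)) y"]
        by (simp add: xy)
    qed (use d in auto)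
  qed
qed

text \<open>Osgood's lemma.\<close>

lemma holomorphic2_on_separately:
  assumes S: "open S" and F: "continuous_on S F"
    and holx: "\<And>x y. (x, y) \<in> S \<Longrightarrow> (\<lambda>s. F (s, y)) field_differentiable at x"
    and holy: "\<And>x y. (x, y) \<in> S \<Longrightarrow> (\<lambda>s. F (x, s)) field_differentiable at y"
  shows "F holomorphic2_on S"
  unfolding holomorphic2_on_def
proof safe
  fix x y assume p: "(x, y) \<in> S"
  obtain A B where AB: "open A" "open B" "x \<in> A" "y \<in> B" "A \<times> B \<subseteq> S"
    by (rule open_prod_boxE[OF S p])
  obtain r where r: "r > 0" "ball y r \<subseteq> B"
    using AB openE by blast
  have c: "continuous_on S (pdy F)" by (rule continuous_on_pdy[OF S F holy])
  \<comment> \<open>Total differentiability follows from both partial derivatives and the continuity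
    of the second, which \<open>continuous_on_pdy\<close> supplies.\<close>
  have "((\<lambda>(x, y). F (x, y)) has_derivative
      (\<lambda>(tx, ty). pdx F (x, y) * tx + blinfun_apply (blinfun_mult_right (pdy F (x, y))) ty))
      (at (x, y) within A \<times> ball y r)"
  proof (rule has_derivative_partialsI)
    have "((\<lambda>s. F (s, y)) has_field_derivative pdx F (x, y)) (at x)"
      using holx[OF p] by (simp add: pdx_def DERIV_deriv_iff_field_differentiable)
    then show "((\<lambda>x. F (x, y)) has_derivative (*) (pdx F (x, y))) (at x within A)"
      by (simp add: has_field_derivative_def has_derivative_at_withinI)
  next
    fix u v assume "u \<in> A" "v \<in> ball y r"
    then have "(u, v) \<in> S" using AB r by auto
    then have "((\<lambda>s. F (u, s)) has_field_derivative pdy F (u, v)) (at v)"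
      using holy by (simp add: pdy_def DERIV_deriv_iff_field_differentiable)
    then show "((\<lambda>y. F (u, y)) has_derivative blinfun_apply (blinfun_mult_right (pdy F (u, v))))
        (at v within ball y r)"
      by (simp add: has_field_derivative_def has_derivative_at_withinI)
  next
    have "continuous (at (x, y) within A \<times> ball y r) (pdy F)"
      using c p S by (simp add: continuous_at_imp_continuous_at_within continuous_on_eq_continuous_at)
    then have "continuous (at (x, y) within A \<times> ball y r) (\<lambda>p. blinfun_mult_right (pdy F p))"
      by (rule bounded_linear.continuous[OF bounded_linear_blinfun_mult_right])
    then show "continuous (at (x, y) within A \<times> ball y r)
        (\<lambda>(x, y). blinfun_mult_right (pdy F (x, y)))"
      by (simp add: case_prod_unfold)
  qed (use r in auto)
  moreover have "at (x, y) within A \<times> ball y r = at (x, y)"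
    using AB r by (intro at_within_open open_Times) auto
  ultimately have "(F has_derivative (\<lambda>(h, k). pdx F (x, y) * h + pdy F (x, y) * k)) (at (x, y))"
    by (simp add: case_prod_unfold)
  then show "\<exists>a b. (F has_derivative (\<lambda>(h, k). a * h + b * k)) (at (x, y) within S)"
    using has_derivative_at_withinI by blast
qed

text \<open>Cauchy's formula for the derivative in the first variable is differentiated under the
  integral sign. At this stage \<open>pdy F\<close> is not known to be differentiable in that
  variable, so the result is left as a Cauchy integral, to be recognised later as
  \<open>pdx (pdy F)\<close>.\<close>

lemma pdx_differentiable_pdy:
  assumes S: "open S" and F: "F holomorphic2_on S" and p: "(x0, y0) \<in> S"
  obtains r where "r > 0" "cball x0 r \<times> {y0} \<subseteq> S"
    "((\<lambda>s. pdx F (x0, s)) has_field_derivative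
      1 / (2 * of_real pi * \<i>) * contour_integral (circlepath x0 r) (\<lambda>u. pdy F (u, y0) / (u - x0)\<^sup>2))
      (at y0)"
proof -
  obtain A B where AB: "open A" "open B" "x0 \<in> A" "y0 \<in> B" "A \<times> B \<subseteq> S"
    by (rule open_prod_boxE[OF S p])
  obtain r where r: "r > 0" "cball x0 r \<subseteq> A"
    using AB open_contains_cball_eq by blast
  obtain d where d: "d > 0" "ball y0 d \<subseteq> B"
    using AB openE by blast
  have inS: "(u, y) \<in> S" if "u \<in> cball x0 r" "y \<in> ball y0 d" for u y
    using that AB(5) r(2) d(2) by (meson SigmaI subsetD)
  have Fc: "continuous_on S F" by (rule holomorphic2_on_imp_continuous_on[OF F])
  have Fy: "continuous_on S (pdy F)"
    using has_field_derivative_pdy[OF F S] field_differentiable_def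
    by (intro continuous_on_pdy[OF S Fc]) blast
  define c where "c = circlepath x0 r"
  \<comment> \<open>The kernel of the contour integral pulled back to the parameter interval, where
    the Leibniz rule for ordinary integrals applies.\<close>
  define k where "k t = vector_derivative c (at t) / (c t - x0)\<^sup>2" for t
  have ct: "c t \<in> cball x0 r" for t
    using r by (simp add: c_def circlepath dist_norm norm_mult)
  have c0: "c t - x0 \<noteq> 0" for t
    using r by (simp add: c_def circlepath)
  have cc: "continuous_on X c" for X
    unfolding c_def circlepath by (intro continuous_intros)
  have kc: "continuous_on X k" for X
    using c0 cc unfolding k_def c_def vector_derivative_circlepath
    by (intro continuous_intros) auto
  have "((\<lambda>y. integral (cbox 0 1) (\<lambda>t. F (c t, y) * k t)) has_field_derivative
      integral (cbox 0 1) (\<lambda>t. pdy F (c t, y0) * k t)) (at y0 within ball y0 d)"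
  proof (rule leibniz_rule_field_derivative)
    fix y t assume y: "y \<in> ball y0 d"
    have "((\<lambda>y. F (c t, y)) has_field_derivative pdy F (c t, y)) (at y)"
      by (rule has_field_derivative_pdy[OF F S inS[OF ct y]])
    then show "((\<lambda>y. F (c t, y) * k t) has_field_derivative pdy F (c t, y) * k t) (at y within ball y0 d)"
      by (rule has_field_derivative_at_within[OF DERIV_cmult_right])
  next
    fix y assume y: "y \<in> ball y0 d"
    have "continuous_on (cbox 0 1) (\<lambda>t. F (c t, y) * k t)"
      using inS[OF ct y]
      by (intro continuous_on_mult kc continuous_on_compose2[OF Fc] continuous_on_Pair continuous_on_const cc) auto
    then show "(\<lambda>t. F (c t, y) * k t) integrable_on cbox 0 1"
      by (rule integrable_continuous)
  next
    have "continuous_on (ball y0 d \<times> cbox 0 1) (\<lambda>z. pdy F (c (snd z), fst z) * k (snd z))"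
    proof (rule continuous_on_mult)
      show "continuous_on (ball y0 d \<times> cbox 0 1) (\<lambda>z. k (snd z))"
        by (rule continuous_on_compose2[OF kc[of UNIV]]) (auto intro: continuous_on_snd continuous_on_id)
      have "continuous_on (ball y0 d \<times> cbox 0 1) (\<lambda>z::complex \<times> real. c (snd z))"
        by (rule continuous_on_compose2[OF cc[of UNIV]]) (auto intro: continuous_on_snd continuous_on_id)
      moreover have "(\<lambda>z::complex \<times> real. (c (snd z), fst z)) ` (ball y0 d \<times> cbox 0 1) \<subseteq> S"
        using inS[OF ct] by auto
      ultimately show "continuous_on (ball y0 d \<times> cbox 0 1) (\<lambda>z. pdy F (c (snd z), fst z))"
        by (intro continuous_on_compose2[OF Fy] continuous_on_Pair)
           (auto intro: continuous_on_fst continuous_on_id)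
    qed
    then show "continuous_on (ball y0 d \<times> cbox 0 1) (\<lambda>(y, t). pdy F (c t, y) * k t)"
      by (simp add: case_prod_unfold)
  qed (use d in auto)
  moreover
  have "integral (cbox 0 1) (\<lambda>t. g (c t) * k t) = contour_integral c (\<lambda>u. g u / (u - x0)\<^sup>2)" for g
    unfolding contour_integral_integral k_def cbox_interval by (rule arg_cong) (simp add: fun_eq_iff)
  note this[of "\<lambda>u. F (u, y)" for y] this[of "\<lambda>u. pdy F (u, y0)"]
  ultimately have D: "((\<lambda>y. contour_integral c (\<lambda>u. F (u, y) / (u - x0)\<^sup>2)) has_field_derivative
      contour_integral c (\<lambda>u. pdy F (u, y0) / (u - x0)\<^sup>2)) (at y0)"
    using d by (simp only: at_within_open[of y0 "ball y0 d", OF _ open_ball] centre_in_ball)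
  have E: "pdx F (x0, y) = 1 / (2 * of_real pi * \<i>) * contour_integral c (\<lambda>u. F (u, y) / (u - x0)\<^sup>2)"
    if y: "y \<in> ball y0 d" for y
  proof -
    have "(\<lambda>u. F (u, y)) holomorphic_on cball x0 r"
      using inS[OF _ y] by (rule holomorphic_on_slice_x[OF F S])
    then have "((\<lambda>u. F (u, y)) has_field_derivative
        1 / (2 * of_real pi * \<i>) * contour_integral c (\<lambda>u. F (u, y) / (u - x0)\<^sup>2)) (at x0)"
      unfolding c_def using r
      by (intro Cauchy_derivative_integral_circlepath)
         (auto intro: holomorphic_on_imp_continuous_on holomorphic_on_subset)
    then show ?thesis by (simp add: pdx_def DERIV_imp_deriv)
  qed
  have "((\<lambda>y. pdx F (x0, y)) has_field_derivative
      1 / (2 * of_real pi * \<i>) * contour_integral c (\<lambda>u. pdy F (u, y0) / (u - x0)\<^sup>2)) (at y0)"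
  proof (rule has_field_derivative_transform_within_open)
    show "((\<lambda>y. 1 / (2 * of_real pi * \<i>) * contour_integral c (\<lambda>u. F (u, y) / (u - x0)\<^sup>2)) has_field_derivative
      1 / (2 * of_real pi * \<i>) * contour_integral c (\<lambda>u. pdy F (u, y0) / (u - x0)\<^sup>2)) (at y0)"
      by (rule DERIV_cmult[OF D])
    show "y0 \<in> ball y0 d" using d by simp
    show "1 / (2 * of_real pi * \<i>) * contour_integral c (\<lambda>u. F (u, y) / (u - x0)\<^sup>2) = pdx F (x0, y)"
      if "y \<in> ball y0 d" for y
      using E[OF that] by simp
  qed simp
  moreover have "cball x0 r \<times> {y0} \<subseteq> S"
    using inS d by auto
  ultimately show thesis
    using that r(1) unfolding c_def by blast
qed

lemma open_slices:
  assumes "open (S :: (complex \<times> complex) set)"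
  shows "open {s. (s, y) \<in> S}" "open {s. (x, s) \<in> S}"
proof -
  have "open ((\<lambda>s. (s, y)) -` S)" "open ((\<lambda>s. (x, s)) -` S)"
    using assms by (intro open_vimage continuous_intros; simp)+
  then show "open {s. (s, y) \<in> S}" "open {s. (x, s) \<in> S}"
    by (simp_all add: vimage_def)
qed

text \<open>By Osgood's lemma. Along the second variable \<open>pdy F\<close> is the derivative of a
  holomorphic function of one variable; along the first it is handled by
  \<open>pdx_differentiable_pdy\<close> with the variables exchanged.\<close>

lemma holomorphic2_on_pdy:
  assumes S: "open S" and F: "F holomorphic2_on S"
  shows "pdy F holomorphic2_on S"
proof (rule holomorphic2_on_separately[OF S])
  show "continuous_on S (pdy F)"
    using has_field_derivative_pdy[OF F S] field_differentiable_def
    by (intro continuous_on_pdy[OF S holomorphic2_on_imp_continuous_on[OF F]]) blast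
next
  fix x y assume p: "(x, y) \<in> S"
  let ?F = "F \<circ> prod.swap"
  obtain r where "((\<lambda>s. pdx ?F (y, s)) has_field_derivative
      1 / (2 * of_real pi * \<i>) * contour_integral (circlepath y r) (\<lambda>u. pdy ?F (u, x) / (u - y)\<^sup>2)) (at x)"
    using p by (rule_tac pdx_differentiable_pdy[OF open_swap_image[OF S] holomorphic2_on_swap[OF F], of y x])
       force
  then show "(\<lambda>s. pdy F (s, y)) field_differentiable at x"
    unfolding pdx_swap field_differentiable_def by blast
  have "(\<lambda>s. F (x, s)) holomorphic_on {s. (x, s) \<in> S}"
    by (rule holomorphic_on_slice_y[OF F S]) simp
  then have "deriv (\<lambda>s. F (x, s)) holomorphic_on {s. (x, s) \<in> S}"
    by (intro holomorphic_deriv open_slices S)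
  then show "(\<lambda>s. pdy F (x, s)) field_differentiable at y"
    using p by (simp add: pdy_def holomorphic_on_imp_differentiable_at[OF _ open_slices(2)[OF S]])
qed

lemma holomorphic2_on_pdx:
  assumes S: "open S" and F: "F holomorphic2_on S"
  shows "pdx F holomorphic2_on S"
proof -
  have "pdy (F \<circ> prod.swap) holomorphic2_on prod.swap ` S"
    by (intro holomorphic2_on_pdy open_swap_image holomorphic2_on_swap S F)
  from holomorphic2_on_swap[OF this] show ?thesis
    by (simp add: pdx_eq_swap[symmetric] image_image)
qed

text \<open>Both sides are the same Cauchy integral of \<open>pdy F\<close> over a circle in the
  first variable.\<close>

lemma pdy_pdx_eq_pdx_pdy:
  assumes S: "open S" and F: "F holomorphic2_on S" and p: "(x, y) \<in> S"
  shows "pdy (pdx F) (x, y) = pdx (pdy F) (x, y)"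
proof -
  obtain r where r: "r > 0" "cball x r \<times> {y} \<subseteq> S"
    and D: "((\<lambda>s. pdx F (x, s)) has_field_derivative
      1 / (2 * of_real pi * \<i>) * contour_integral (circlepath x r) (\<lambda>u. pdy F (u, y) / (u - x)\<^sup>2)) (at y)"
    by (rule pdx_differentiable_pdy[OF S F p])
  have "(\<lambda>u. pdy F (u, y)) holomorphic_on cball x r"
    using r by (intro holomorphic_on_slice_x[OF holomorphic2_on_pdy[OF S F] S]) auto
  then have "((\<lambda>u. pdy F (u, y)) has_field_derivative
      1 / (2 * of_real pi * \<i>) * contour_integral (circlepath x r) (\<lambda>u. pdy F (u, y) / (u - x)\<^sup>2)) (at x)"
    using r
    by (intro Cauchy_derivative_integral_circlepath)
       (auto intro: holomorphic_on_imp_continuous_on holomorphic_on_subset)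
  with D show ?thesis
    by (simp add: pdx_def pdy_def DERIV_imp_deriv)
qed

section \<open>Closure properties of holomorphic functions of two variables\<close>

lemma holomorphic2_on_const: "(\<lambda>_. c) holomorphic2_on S"
  unfolding holomorphic2_on_def
  by (intro ballI exI[of _ 0]) (simp add: case_prod_unfold)

lemma holomorphic2_on_add:
  assumes "F holomorphic2_on S" "G holomorphic2_on S"
  shows "(\<lambda>p. F p + G p) holomorphic2_on S"
  unfolding holomorphic2_on_def
proof
  fix p assume "p \<in> S"
  then obtain a b where F: "(F has_derivative (\<lambda>(h, k). a * h + b * k)) (at p within S)"
    using assms(1) unfolding holomorphic2_on_def by blast
  obtain a' b' where G: "(G has_derivative (\<lambda>(h, k). a' * h + b' * k)) (at p within S)"
    using \<open>p \<in> S\<close> assms(2) unfolding holomorphic2_on_def by blast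
  from has_derivative_add[OF F G]
  have "((\<lambda>p. F p + G p) has_derivative (\<lambda>(h, k). (a + a') * h + (b + b') * k)) (at p within S)"
    by (rule has_derivative_eq_rhs) (auto simp: algebra_simps)
  then show "\<exists>a b. ((\<lambda>p. F p + G p) has_derivative (\<lambda>(h, k). a * h + b * k)) (at p within S)"
    by blast
qed

lemma holomorphic2_on_mult:
  assumes "F holomorphic2_on S" "G holomorphic2_on S"
  shows "(\<lambda>p. F p * G p) holomorphic2_on S"
  unfolding holomorphic2_on_def
proof
  fix p assume "p \<in> S"
  then obtain a b where F: "(F has_derivative (\<lambda>(h, k). a * h + b * k)) (at p within S)"
    using assms(1) unfolding holomorphic2_on_def by blast
  obtain a' b' where G: "(G has_derivative (\<lambda>(h, k). a' * h + b' * k)) (at p within S)"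
    using \<open>p \<in> S\<close> assms(2) unfolding holomorphic2_on_def by blast
  from has_derivative_mult[OF F G]
  have "((\<lambda>p. F p * G p) has_derivative (\<lambda>(h, k). (F p * a' + a * G p) * h + (F p * b' + b * G p) * k))
      (at p within S)"
    by (rule has_derivative_eq_rhs) (auto simp: algebra_simps)
  then show "\<exists>a b. ((\<lambda>p. F p * G p) has_derivative (\<lambda>(h, k). a * h + b * k)) (at p within S)"
    by blast
qed

lemma holomorphic2_on_compose:
  assumes f: "f holomorphic_on T" "open T" and F: "F holomorphic2_on S"
    and sub: "\<And>p. p \<in> S \<Longrightarrow> F p \<in> T"
  shows "(\<lambda>p. f (F p)) holomorphic2_on S"
  unfolding holomorphic2_on_def
proof
  fix p assume p: "p \<in> S"
  then obtain a b where ab: "(F has_derivative (\<lambda>(h, k). a * h + b * k)) (at p within S)"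
    using F by (auto simp: holomorphic2_on_def)
  have "(f has_derivative (*) (deriv f (F p))) (at (F p))"
    using holomorphic_derivI[OF f sub[OF p]] by (simp add: has_field_derivative_def)
  from has_derivative_compose[OF ab this]
  have "((\<lambda>p. f (F p)) has_derivative (\<lambda>(h, k). (deriv f (F p) * a) * h + (deriv f (F p) * b) * k))
      (at p within S)"
    by (rule has_derivative_eq_rhs) (auto simp: algebra_simps)
  then show "\<exists>a b. ((\<lambda>p. f (F p)) has_derivative (\<lambda>(h, k). a * h + b * k)) (at p within S)"
    by blast
qed

section \<open>Self-adjoint second-order equations and analytic continuation\<close>

text \<open>The Sturm-Liouville operator \<open>(p f')' - q f\<close> with the product rule carried
  out.\<close>

definition sl_op :: "(complex \<Rightarrow> complex) \<Rightarrow> (complex \<Rightarrow> complex) \<Rightarrow> (complex \<Rightarrow> complex) \<Rightarrow> complex \<Rightarrow> complex" where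
  "sl_op p q f z = p z * deriv (deriv f) z + deriv p z * deriv f z - q z * f z"

text \<open>The factor \<open>p\<close> makes this constant, not merely a solution of a first-order
  equation, when \<open>f\<close> and \<open>g\<close> solve the same equation.\<close>

definition wronskian :: "(complex \<Rightarrow> complex) \<Rightarrow> (complex \<Rightarrow> complex) \<Rightarrow> (complex \<Rightarrow> complex) \<Rightarrow> complex \<Rightarrow> complex" where
  "wronskian p f g z = p z * (f z * deriv g z - deriv f z * g z)"

lemma deriv_cong_open:
  assumes "open S" "\<And>z. z \<in> S \<Longrightarrow> f z = g z" "z \<in> S"
  shows "deriv f z = deriv g z"
  using assms by (intro deriv_cong_ev) (auto simp: eventually_nhds)

lemma sl_op_cong:
  assumes "open S" "\<And>z. z \<in> S \<Longrightarrow> f z = g z" "z \<in> S"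
  shows "sl_op p q f z = sl_op p q g z"
proof -
  have "deriv f w = deriv g w" if "w \<in> S" for w
    using assms that by (intro deriv_cong_open[of S])
  then have "deriv (deriv f) z = deriv (deriv g) z" "deriv f z = deriv g z" "f z = g z"
    using assms by (auto intro: deriv_cong_open[of S])
  then show ?thesis by (simp add: sl_op_def)
qed

lemma wronskian_cong:
  assumes "open S" "\<And>z. z \<in> S \<Longrightarrow> f z = g z" "z \<in> S"
  shows "wronskian p h f z = wronskian p h g z"
  using assms deriv_cong_open[of S f g z] by (simp add: wronskian_def)

lemma holomorphic_sl_op:
  assumes "open S" "p holomorphic_on S" "q holomorphic_on S" "f holomorphic_on S"
  shows "sl_op p q f holomorphic_on S"
  unfolding sl_op_def using assms by (intro holomorphic_intros holomorphic_deriv)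

lemma holomorphic_wronskian:
  assumes "open S" "p holomorphic_on S" "f holomorphic_on S" "g holomorphic_on S"
  shows "wronskian p f g holomorphic_on S"
  unfolding wronskian_def using assms by (intro holomorphic_intros holomorphic_deriv)

text \<open>Lagrange's identity: with \<open>L = sl_op p q\<close>, the derivative of
  \<open>p (f g' - f' g)\<close> is \<open>f L g - g L f\<close>.\<close>

lemma wronskian_constant:
  assumes S: "open S" "connected S"
    and hol: "p holomorphic_on S" "f holomorphic_on S" "g holomorphic_on S"
    and f: "\<And>z. z \<in> S \<Longrightarrow> sl_op p q f z = 0" and g: "\<And>z. z \<in> S \<Longrightarrow> sl_op p q g z = 0"
    and zw: "z \<in> S" "w \<in> S"
  shows "wronskian p f g z = wronskian p f g w"
proof -
  have "(wronskian p f g has_field_derivative 0) (at z)" if z: "z \<in> S" for z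
  proof -
    have D: "(h has_field_derivative deriv h z) (at z)" if "h holomorphic_on S" for h
      using that S z by (rule_tac holomorphic_derivI)
    have "(wronskian p f g has_field_derivative
        (deriv p z * (f z * deriv g z - deriv f z * g z) +
         p z * ((deriv f z * deriv g z + f z * deriv (deriv g) z)
           - (deriv (deriv f) z * g z + deriv f z * deriv g z)))) (at z)"
      unfolding wronskian_def
      by (rule derivative_eq_intros D hol holomorphic_deriv S(1) refl | simp)+
    also have "deriv p z * (f z * deriv g z - deriv f z * g z) +
         p z * ((deriv f z * deriv g z + f z * deriv (deriv g) z)
           - (deriv (deriv f) z * g z + deriv f z * deriv g z))
         = f z * sl_op p q g z - g z * sl_op p q f z"
      by (simp add: sl_op_def algebra_simps)
    also have "\<dots> = 0" using f g z by simp
    finally show ?thesis .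
  qed
  moreover have "continuous_on S (wronskian p f g)"
    by (intro holomorphic_on_imp_continuous_on holomorphic_wronskian S hol)
  ultimately show ?thesis
    using DERIV_zero_connected_constant[OF S(2,1) finite.emptyI, of "wronskian p f g"] zw
    by (metis Diff_iff)
qed

lemma wronskian_independent:
  assumes S: "open S" "z \<in> S"
    and hol: "f holomorphic_on S" "g holomorphic_on S"
    and W: "wronskian p f g z \<noteq> 0"
    and zero: "\<And>w. w \<in> S \<Longrightarrow> \<alpha> * f w + \<beta> * g w = 0"
  shows "\<alpha> = 0" "\<beta> = 0"
proof -
  have "((\<lambda>w. \<alpha> * f w + \<beta> * g w) has_field_derivative (\<alpha> * deriv f z + \<beta> * deriv g z)) (at z)"
    by (intro DERIV_add DERIV_cmult holomorphic_derivI[OF _ S] hol)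
  moreover have "((\<lambda>w. \<alpha> * f w + \<beta> * g w) has_field_derivative 0) (at z)"
    by (rule has_field_derivative_transform_within_open[OF DERIV_const[of 0] S]) (simp add: zero)
  ultimately have 1: "\<alpha> * deriv f z + \<beta> * deriv g z = 0"
    by (rule DERIV_unique)
  have 2: "\<alpha> * f z + \<beta> * g z = 0" using zero S by simp
  \<comment> \<open>Cramer's rule for the two linear equations given by the relation and its
    derivative.\<close>
  have "\<alpha> * wronskian p f g z = p z * (deriv g z * (\<alpha> * f z + \<beta> * g z) - g z * (\<alpha> * deriv f z + \<beta> * deriv g z))"
    "\<beta> * wronskian p f g z = p z * (f z * (\<alpha> * deriv f z + \<beta> * deriv g z) - deriv f z * (\<alpha> * f z + \<beta> * g z))"
    by (simp_all add: wronskian_def algebra_simps)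
  then show "\<alpha> = 0" "\<beta> = 0" using W unfolding 1 2 by simp_all
qed

text \<open>Solving \<open>u = \<alpha> f + \<beta> g\<close> together with its derivative by
  Cramer's rule gives coefficients that are quotients of Wronskians of solutions, hence
  constants.\<close>

lemma sl_op_span:
  assumes S: "open S" "connected S" "z0 \<in> S"
    and hol: "p holomorphic_on S" "f holomorphic_on S" "g holomorphic_on S" "u holomorphic_on S"
    and eq: "\<And>z. z \<in> S \<Longrightarrow> sl_op p q f z = 0" "\<And>z. z \<in> S \<Longrightarrow> sl_op p q g z = 0"
      "\<And>z. z \<in> S \<Longrightarrow> sl_op p q u z = 0"
    and W: "wronskian p f g z0 \<noteq> 0"
  obtains \<alpha> \<beta> where "\<And>z. z \<in> S \<Longrightarrow> u z = \<alpha> * f z + \<beta> * g z"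
proof
  fix z assume z: "z \<in> S"
  have "wronskian p f g z * u z = wronskian p u g z * f z + wronskian p f u z * g z"
    by (simp add: wronskian_def algebra_simps)
  moreover have "wronskian p f g z = wronskian p f g z0" "wronskian p u g z = wronskian p u g z0"
      "wronskian p f u z = wronskian p f u z0"
    using S z hol eq by (auto intro!: wronskian_constant[where S = S and q = q])
  ultimately show "u z = wronskian p u g z0 / wronskian p f g z0 * f z
      + wronskian p f u z0 / wronskian p f g z0 * g z"
    using W by (simp add: field_simps)
qed

section \<open>Permanence of differential relations under analytic continuation\<close>

lemma holomorphic_zero_on_ball:
  assumes "\<phi> holomorphic_on ball c r" "w \<in> ball c r" "\<forall>\<^sub>F z in nhds w. \<phi> z = 0" "z \<in> ball c r"
  shows "\<phi> z = 0"
proof -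
  obtain S where S: "open S" "w \<in> S" "\<And>z. z \<in> S \<Longrightarrow> \<phi> z = 0"
    using assms(3) by (auto simp: eventually_nhds)
  show ?thesis
    by (rule analytic_continuation_open[of "S \<inter> ball c r" "ball c r" \<phi> "\<lambda>_. 0"])
       (use assms S in auto)
qed

text \<open>\<open>D\<close> stands for a differential operator with coefficients holomorphic on \<open>P\<close>.\<close>

lemma continues_along_permanence:
  fixes D :: "(complex \<Rightarrow> complex) \<Rightarrow> complex \<Rightarrow> complex"
  assumes cont: "continues_along \<gamma> f g" and P: "open P" "path_image \<gamma> \<subseteq> P"
    and cong: "\<And>S h h' z. open S \<Longrightarrow> (\<And>z. z \<in> S \<Longrightarrow> h z = h' z) \<Longrightarrow> z \<in> S \<Longrightarrow> D h z = D h' z"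
    and hol: "\<And>S h. open S \<Longrightarrow> S \<subseteq> P \<Longrightarrow> h holomorphic_on S \<Longrightarrow> D h holomorphic_on S"
    and base: "\<forall>\<^sub>F z in nhds (pathstart \<gamma>). D f z = 0"
  shows "\<forall>\<^sub>F z in nhds (pathfinish \<gamma>). D g z = 0"
proof -
  have ev: "(\<forall>\<^sub>F z in nhds w. D h z = 0) \<longleftrightarrow> (\<forall>\<^sub>F z in nhds w. D h' z = 0)"
    if eq: "\<forall>\<^sub>F z in nhds w. h z = h' z" for h h' w
  proof -
    obtain S where S: "open S" "w \<in> S" "\<And>z. z \<in> S \<Longrightarrow> h z = h' z"
      using eq by (auto simp: eventually_nhds)
    then have "\<forall>\<^sub>F z in nhds w. D h z = D h' z"
      using cong[of S h h'] by (auto simp: eventually_nhds)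
    then show ?thesis by (rule eventually_subst[OF eventually_mono]) auto
  qed
  from cont obtain h where path: "path \<gamma>"
    and an: "\<And>t. t \<in> {0..1} \<Longrightarrow> h t analytic_on {\<gamma> t}"
    and loc: "\<And>t. t \<in> {0..1} \<Longrightarrow> \<forall>\<^sub>F u in at t within {0..1}. \<forall>\<^sub>F z in nhds (\<gamma> u). h u z = h t z"
    and h0: "\<forall>\<^sub>F z in nhds (pathstart \<gamma>). h 0 z = f z"
    and h1: "\<forall>\<^sub>F z in nhds (pathfinish \<gamma>). h 1 z = g z"
    unfolding continues_along_def by blast
  define Q where "Q t \<longleftrightarrow> (\<forall>\<^sub>F z in nhds (\<gamma> t). D (h t) z = 0)" for t
  have "Q 1"
  proof (rule connected_induction_simple[of "{0..1::real}" 0 1 Q])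
    show "Q 0" using ev[OF h0] base by (simp add: Q_def pathstart_def)
    fix t :: real assume t: "t \<in> {0..1}"
    obtain r1 where r1: "r1 > 0" "h t holomorphic_on ball (\<gamma> t) r1"
      using an[OF t] by (auto simp: analytic_on_def)
    have "\<gamma> t \<in> P" using P(2) t by (auto simp: path_image_def)
    then obtain r2 where r2: "r2 > 0" "ball (\<gamma> t) r2 \<subseteq> P" using P(1) openE by blast
    define r where "r = min r1 r2"
    have r: "r > 0" "ball (\<gamma> t) r \<subseteq> P" "h t holomorphic_on ball (\<gamma> t) r"
      using r1 r2 by (auto simp: r_def intro: holomorphic_on_subset)
    have Dh: "D (h t) holomorphic_on ball (\<gamma> t) r"
      by (rule hol[OF open_ball r(2,3)])
    have "continuous (at t within {0..1}) \<gamma>"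
      using path t by (simp add: path_def continuous_on_eq_continuous_within)
    then have "\<forall>\<^sub>F u in at t within {0..1}. \<gamma> u \<in> ball (\<gamma> t) r"
      using r(1) unfolding continuous_within tendsto_iff by (simp add: dist_commute)
    with loc[OF t] have "\<forall>\<^sub>F u in at t within {0..1}.
        (\<forall>\<^sub>F z in nhds (\<gamma> u). h u z = h t z) \<and> \<gamma> u \<in> ball (\<gamma> t) r"
      by (rule eventually_conj)
    then obtain d where d: "d > 0" "\<And>u. u \<in> {0..1} \<Longrightarrow> u \<noteq> t \<Longrightarrow> dist u t < d \<Longrightarrow>
        (\<forall>\<^sub>F z in nhds (\<gamma> u). h u z = h t z) \<and> \<gamma> u \<in> ball (\<gamma> t) r"
      unfolding eventually_at by blast
    \<comment> \<open>For \<open>u\<close> near \<open>t\<close>, the identity theorem turns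
      \<open>Q u\<close> into a condition that does not mention \<open>u\<close>: if
      \<open>D (h t)\<close> vanishes near one point of the ball, it vanishes on all of it. So
      \<open>Q\<close> is locally constant on the interval.\<close>
    have T: "Q u \<longleftrightarrow> (\<forall>z \<in> ball (\<gamma> t) r. D (h t) z = 0)" if u: "u \<in> {0..1} \<inter> ball t d" for u
    proof -
      have u': "\<forall>\<^sub>F z in nhds (\<gamma> u). h u z = h t z" "\<gamma> u \<in> ball (\<gamma> t) r"
        using d(2)[of u] u r(1) by (cases "u = t"; force simp: dist_commute)+
      have "Q u \<longleftrightarrow> (\<forall>\<^sub>F z in nhds (\<gamma> u). D (h t) z = 0)"
        unfolding Q_def by (rule ev[OF u'(1)])
      also have "\<dots> \<longleftrightarrow> (\<forall>z \<in> ball (\<gamma> t) r. D (h t) z = 0)"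
        using holomorphic_zero_on_ball[OF Dh u'(2)] u'(2) open_ball
        unfolding eventually_nhds by metis
      finally show ?thesis .
    qed
    show "\<exists>T. openin (top_of_set {0..1}) T \<and> t \<in> T \<and> (\<forall>x\<in>T. \<forall>y\<in>T. Q x \<longrightarrow> Q y)"
      using t d(1) T by (intro exI[of _ "{0..1} \<inter> ball t d"]) (auto simp: openin_open_Int)
  qed auto
  then show ?thesis using ev[OF h1] by (simp add: Q_def pathfinish_def)
qed

section \<open>Products of solutions in two separate variables\<close>

lemma sl_op_cmult:
  assumes "open S" "f holomorphic_on S" "z \<in> S"
  shows "sl_op p q (\<lambda>s. c * f s) z = c * sl_op p q f z"
proof -
  have d: "deriv (\<lambda>s. c * h s) w = c * deriv h w" if "h holomorphic_on S" "w \<in> S" for h w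
    using holomorphic_on_imp_differentiable_at[OF that(1) assms(1) that(2)] by (rule deriv_cmult)
  have "deriv (deriv (\<lambda>s. c * f s)) z = deriv (\<lambda>s. c * deriv f s) z"
    by (rule deriv_cong_open[OF assms(1) d[OF assms(2)] assms(3)])
  also have "\<dots> = c * deriv (deriv f) z"
    by (rule d[OF holomorphic_deriv[OF assms(2,1)] assms(3)])
  finally show ?thesis
    by (simp add: sl_op_def d[OF assms(2,3)] algebra_simps)
qed

text \<open>With the second variable fixed, the hypothesis is a relation between \<open>f1\<close>
  and \<open>f2\<close>. Its coefficients therefore vanish, and they are relations between
  \<open>g1\<close> and \<open>g2\<close>.\<close>

lemma wronskian_independent2:
  assumes A: "open A" "a \<in> A" "f1 holomorphic_on A" "f2 holomorphic_on A"
    and B: "open B" "b \<in> B" "g1 holomorphic_on B" "g2 holomorphic_on B"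
    and W: "wronskian p f1 f2 a \<noteq> 0" "wronskian p g1 g2 b \<noteq> 0"
    and zero: "\<And>s t. s \<in> A \<Longrightarrow> t \<in> B \<Longrightarrow>
      c0 * (f1 s * g1 t) + c1 * (f2 s * g1 t) + c2 * (f1 s * g2 t) + c3 * (f2 s * g2 t) = 0"
  shows "c0 = 0 \<and> c1 = 0 \<and> c2 = 0 \<and> c3 = 0"
proof -
  have "c0 * g1 t + c2 * g2 t = 0" "c1 * g1 t + c3 * g2 t = 0" if t: "t \<in> B" for t
  proof -
    have "(c0 * g1 t + c2 * g2 t) * f1 s + (c1 * g1 t + c3 * g2 t) * f2 s = 0" if "s \<in> A" for s
      using zero[OF that t] by (simp add: algebra_simps)
    then show "c0 * g1 t + c2 * g2 t = 0" "c1 * g1 t + c3 * g2 t = 0"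
      using wronskian_independent[OF A W(1)] by blast+
  qed
  then show ?thesis
    using wronskian_independent[OF B W(2), of c0 c2] wronskian_independent[OF B W(2), of c1 c3] by blast
qed

text \<open>For each \<open>t\<close> the function \<open>G s t\<close> is a combination of
  \<open>f1\<close> and \<open>f2\<close> whose coefficients depend on \<open>t\<close> in an
  unknown way. Evaluation at two points \<open>a\<close>, \<open>a'\<close> expresses these
  coefficients through \<open>G a t\<close> and \<open>G a' t\<close>, which are known to solve the
  equation in \<open>t\<close>.\<close>

lemma sl_op_span2:
  assumes A: "open A" "connected A" "a \<in> A" "p holomorphic_on A" "f1 holomorphic_on A" "f2 holomorphic_on A"
    and B: "open B" "connected B" "b \<in> B" "p holomorphic_on B" "g1 holomorphic_on B" "g2 holomorphic_on B"
    and f: "\<And>s. s \<in> A \<Longrightarrow> sl_op p q f1 s = 0" "\<And>s. s \<in> A \<Longrightarrow> sl_op p q f2 s = 0"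
    and g: "\<And>t. t \<in> B \<Longrightarrow> sl_op p q g1 t = 0" "\<And>t. t \<in> B \<Longrightarrow> sl_op p q g2 t = 0"
    and W: "wronskian p f1 f2 a \<noteq> 0" "wronskian p g1 g2 b \<noteq> 0"
    and GA: "\<And>t. t \<in> B \<Longrightarrow> (\<lambda>s. G s t) holomorphic_on A"
      "\<And>s t. s \<in> A \<Longrightarrow> t \<in> B \<Longrightarrow> sl_op p q (\<lambda>s. G s t) s = 0"
    and GB: "\<And>s. s \<in> A \<Longrightarrow> (\<lambda>t. G s t) holomorphic_on B"
      "\<And>s t. s \<in> A \<Longrightarrow> t \<in> B \<Longrightarrow> sl_op p q (\<lambda>t. G s t) t = 0"
  obtains c0 c1 c2 c3 where "\<And>s t. s \<in> A \<Longrightarrow> t \<in> B \<Longrightarrow>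
    G s t = c0 * (f1 s * g1 t) + c1 * (f2 s * g1 t) + c2 * (f1 s * g2 t) + c3 * (f2 s * g2 t)"
proof -
  \<comment> \<open>If the determinant vanished for every \<open>a'\<close>, then
    \<open>- f2 a\<close> and \<open>f1 a\<close> would be the coefficients of a relation between
    \<open>f1\<close> and \<open>f2\<close>. Both would be 0, and so would the Wronskian at
    \<open>a\<close>.\<close>
  obtain a' where a': "a' \<in> A" and det: "f1 a * f2 a' - f2 a * f1 a' \<noteq> 0"
  proof (rule ccontr)
    assume "\<not> thesis"
    with that have "f1 a * f2 s - f2 a * f1 s = 0" if "s \<in> A" for s
      using that by blast
    then have "- f2 a * f1 s + f1 a * f2 s = 0" if "s \<in> A" for s
      using that by (simp add: algebra_simps)
    then have "- f2 a = 0" "f1 a = 0"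
      using wronskian_independent[OF A(1,3,5,6) W(1)] by blast+
    then show False using W(1) by (simp add: wronskian_def)
  qed
  obtain d0 d1 where d: "\<And>t. t \<in> B \<Longrightarrow> G a t = d0 * g1 t + d1 * g2 t"
    by (rule sl_op_span[OF B GB(1)[OF A(3)] _ _ _ W(2)]) (use g GB(2)[OF A(3)] in blast)+
  obtain d0' d1' where d': "\<And>t. t \<in> B \<Longrightarrow> G a' t = d0' * g1 t + d1' * g2 t"
    by (rule sl_op_span[OF B GB(1)[OF a'] _ _ _ W(2)]) (use g GB(2)[OF a'] in blast)+
  define D where "D = f1 a * f2 a' - f2 a * f1 a'"
  have "G s t = (d0 * f2 a' - d0' * f2 a) / D * (f1 s * g1 t) + (d0' * f1 a - d0 * f1 a') / D * (f2 s * g1 t)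
      + (d1 * f2 a' - d1' * f2 a) / D * (f1 s * g2 t) + (d1' * f1 a - d1 * f1 a') / D * (f2 s * g2 t)"
    if s: "s \<in> A" and t: "t \<in> B" for s t
  proof -
    obtain \<alpha> \<beta> where ab: "\<And>s. s \<in> A \<Longrightarrow> G s t = \<alpha> * f1 s + \<beta> * f2 s"
      by (rule sl_op_span[OF A GA(1)[OF t] _ _ _ W(1)]) (use f GA(2)[OF _ t] in blast)+
    \<comment> \<open>Cramer's rule for the values of \<open>G\<close> at \<open>a\<close> and
      \<open>a'\<close>.\<close>
    have "\<alpha> * D = G a t * f2 a' - G a' t * f2 a" "\<beta> * D = G a' t * f1 a - G a t * f1 a'"
      unfolding ab[OF A(3)] ab[OF a'] D_def by (simp_all add: algebra_simps)
    then have "G s t * D = (G a t * f2 a' - G a' t * f2 a) * f1 s + (G a' t * f1 a - G a t * f1 a') * f2 s"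
      unfolding ab[OF s] by algebra
    then have "G s t = ((G a t * f2 a' - G a' t * f2 a) * f1 s + (G a' t * f1 a - G a t * f1 a') * f2 s) / D"
      using det by (simp add: D_def nonzero_eq_divide_eq)
    also have "\<dots> = (d0 * f2 a' - d0' * f2 a) / D * (f1 s * g1 t) + (d0' * f1 a - d0 * f1 a') / D * (f2 s * g1 t)
      + (d1 * f2 a' - d1' * f2 a) / D * (f1 s * g2 t) + (d1' * f1 a - d1 * f1 a') / D * (f2 s * g2 t)"
      unfolding d[OF t] d'[OF t] divide_inverse by algebra
    finally show ?thesis .
  qed
  then show thesis using that by blast
qed

section \<open>The differential equations of the elliptic integral\<close>

text \<open>The first operator annihilates \<open>K(m)\<close>, the second \<open>K(s\<^sup>2)\<close>.\<close>

abbreviation "param_op \<equiv> sl_op (\<lambda>m. m * (1 - m)) (\<lambda>_. 1/4)"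
abbreviation "param_wronskian \<equiv> wronskian (\<lambda>m. m * (1 - m))"
abbreviation "modulus_op \<equiv> sl_op (\<lambda>s. s * (1 - s\<^sup>2)) (\<lambda>s. s)"
abbreviation "modulus_wronskian \<equiv> wronskian (\<lambda>s. s * (1 - s\<^sup>2))"

lemma param_op_eq: "param_op f z = z * (1 - z) * deriv (deriv f) z + (1 - 2 * z) * deriv f z - 1/4 * f z"
proof -
  have "((\<lambda>m. m * (1 - m)) has_field_derivative (1 - 2 * z)) (at z)"
    by (auto intro!: derivative_eq_intros)
  then show ?thesis by (simp add: sl_op_def DERIV_imp_deriv)
qed

lemma modulus_op_eq:
  "modulus_op f z = z * (1 - z\<^sup>2) * deriv (deriv f) z + (1 - 3 * z\<^sup>2) * deriv f z - z * f z"
proof -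
  have "((\<lambda>s. s * (1 - s\<^sup>2)) has_field_derivative (1 - 3 * z\<^sup>2)) (at z)"
    by (auto intro!: derivative_eq_intros simp: power2_eq_square)
  then show ?thesis by (simp add: sl_op_def DERIV_imp_deriv)
qed

lemma deriv_compose_diff1:
  assumes "open S" "f holomorphic_on S" "1 - z \<in> S"
  shows "deriv (\<lambda>m. f (1 - m)) z = - deriv f (1 - z)"
proof -
  have "(f has_field_derivative deriv f (1 - z)) (at (1 - z))"
    using assms by (intro holomorphic_derivI)
  moreover have "((\<lambda>m. 1 - m) has_field_derivative -1) (at z)"
    by (auto intro!: derivative_eq_intros)
  ultimately have "((\<lambda>m. f (1 - m)) has_field_derivative deriv f (1 - z) * -1) (at z)"
    by (rule DERIV_chain2)
  then show ?thesis by (simp add: DERIV_imp_deriv)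
qed

lemma deriv_compose_square:
  assumes "open S" "f holomorphic_on S" "z\<^sup>2 \<in> S"
  shows "deriv (\<lambda>s. f (s\<^sup>2)) z = 2 * z * deriv f (z\<^sup>2)"
proof -
  have "(f has_field_derivative deriv f (z\<^sup>2)) (at (z\<^sup>2))"
    using assms by (intro holomorphic_derivI)
  moreover have "((\<lambda>s. s\<^sup>2) has_field_derivative 2 * z) (at z)"
    by (auto intro!: derivative_eq_intros)
  ultimately have "((\<lambda>s. f (s\<^sup>2)) has_field_derivative deriv f (z\<^sup>2) * (2 * z)) (at z)"
    by (rule DERIV_chain2)
  then show ?thesis by (simp add: DERIV_imp_deriv)
qed

lemma open_vimage_diff1: "open {z. 1 - z \<in> S}" if "open S" for S :: "complex set"
  using open_vimage[OF that, of "\<lambda>z. 1 - z"] by (simp add: vimage_def continuous_intros)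

lemma open_vimage_square: "open {z. z\<^sup>2 \<in> S}" if "open S" for S :: "complex set"
  using open_vimage[OF that, of "\<lambda>z. z\<^sup>2"] by (simp add: vimage_def continuous_intros)

lemma holomorphic_compose_diff1:
  assumes "f holomorphic_on S" shows "(\<lambda>m. f (1 - m)) holomorphic_on {z. 1 - z \<in> S}"
proof -
  have "f \<circ> (\<lambda>m. 1 - m) holomorphic_on {z. 1 - z \<in> S}"
    by (rule holomorphic_on_compose_gen[OF _ assms]) (auto intro!: holomorphic_intros)
  then show ?thesis by (simp add: o_def)
qed

lemma holomorphic_compose_square:
  assumes "f holomorphic_on S" shows "(\<lambda>s. f (s\<^sup>2)) holomorphic_on {z. z\<^sup>2 \<in> S}"
proof -
  have "f \<circ> (\<lambda>s. s\<^sup>2) holomorphic_on {z. z\<^sup>2 \<in> S}"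
    by (rule holomorphic_on_compose_gen[OF _ assms]) (auto intro!: holomorphic_intros)
  then show ?thesis by (simp add: o_def)
qed

text \<open>The coefficient \<open>m (1 - m)\<close> is symmetric about 1/2; its derivative and that
  of \<open>f\<close> both change sign under the reflection.\<close>

lemma param_op_reflect:
  assumes "open S" "f holomorphic_on S" "1 - z \<in> S"
  shows "param_op (\<lambda>m. f (1 - m)) z = param_op f (1 - z)"
proof -
  have "deriv (deriv (\<lambda>m. f (1 - m))) z = deriv (\<lambda>m. - deriv f (1 - m)) z"
    using assms by (intro deriv_cong_open[OF open_vimage_diff1[of S]] deriv_compose_diff1) auto
  also have "\<dots> = - deriv (\<lambda>u. - deriv f u) (1 - z)"
    using assms by (intro deriv_compose_diff1[of S "\<lambda>u. - deriv f u"] holomorphic_on_minus holomorphic_deriv)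
  also have "\<dots> = deriv (deriv f) (1 - z)"
    using assms holomorphic_deriv[of f S]
    by (subst deriv_minus) (auto intro: holomorphic_on_imp_differentiable_at)
  finally show ?thesis
    unfolding param_op_eq deriv_compose_diff1[OF assms] by (simp add: algebra_simps)
qed

lemma modulus_op_square:
  assumes "open S" "f holomorphic_on S" "z\<^sup>2 \<in> S"
  shows "modulus_op (\<lambda>s. f (s\<^sup>2)) z = 4 * z * param_op f (z\<^sup>2)"
proof -
  have f': "deriv f holomorphic_on S" using assms by (intro holomorphic_deriv)
  have "(\<lambda>s. deriv f (s\<^sup>2)) holomorphic_on {z. z\<^sup>2 \<in> S}"
    by (rule holomorphic_compose_square[OF f'])
  then have "((\<lambda>s. deriv f (s\<^sup>2)) has_field_derivative deriv (\<lambda>s. deriv f (s\<^sup>2)) z) (at z)"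
    using assms by (intro holomorphic_derivI[OF _ open_vimage_square[of S]]) auto
  then have D: "((\<lambda>s. deriv f (s\<^sup>2)) has_field_derivative 2 * z * deriv (deriv f) (z\<^sup>2)) (at z)"
    by (simp add: deriv_compose_square[OF assms(1) f' assms(3)])
  have "deriv (deriv (\<lambda>s. f (s\<^sup>2))) z = deriv (\<lambda>s. 2 * s * deriv f (s\<^sup>2)) z"
    using assms by (intro deriv_cong_open[OF open_vimage_square[of S]] deriv_compose_square) auto
  have "((\<lambda>s. 2 * s * deriv f (s\<^sup>2)) has_field_derivative
      2 * deriv f (z\<^sup>2) + 2 * z * deriv (deriv f) (z\<^sup>2) * (2 * z)) (at z)"
    using DERIV_mult[OF DERIV_cmult_Id[of 2 z] D] by (simp add: mult_ac)
  then have "deriv (\<lambda>s. 2 * s * deriv f (s\<^sup>2)) z = 2 * deriv f (z\<^sup>2) + 4 * z\<^sup>2 * deriv (deriv f) (z\<^sup>2)"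
    by (simp add: DERIV_imp_deriv power2_eq_square)
  with \<open>deriv (deriv (\<lambda>s. f (s\<^sup>2))) z = _\<close>
  have D2: "deriv (deriv (\<lambda>s. f (s\<^sup>2))) z = 2 * deriv f (z\<^sup>2) + 4 * z\<^sup>2 * deriv (deriv f) (z\<^sup>2)"
    by simp
  show ?thesis
    unfolding param_op_eq modulus_op_eq D2 deriv_compose_square[OF assms]
    by (simp add: algebra_simps power2_eq_square)
qed

lemma modulus_wronskian_square:
  assumes "open S" "f holomorphic_on S" "g holomorphic_on S" "z\<^sup>2 \<in> S"
  shows "modulus_wronskian (\<lambda>s. f (s\<^sup>2)) (\<lambda>s. g (s\<^sup>2)) z = 2 * param_wronskian f g (z\<^sup>2)"
  using assms by (simp add: wronskian_def deriv_compose_square[of S])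
    (simp add: algebra_simps power2_eq_square)

lemma param_wronskian_reflect:
  assumes "open S" "f holomorphic_on S" "g holomorphic_on S" "1 - z \<in> S"
  shows "param_wronskian (\<lambda>m. f (1 - m)) (\<lambda>m. g (1 - m)) z = - param_wronskian f g (1 - z)"
  using assms by (simp add: wronskian_def deriv_compose_diff1[of S])
    (simp add: algebra_simps)

lemma modulus_op_one_minus_square:
  assumes "open S" "f holomorphic_on S" "1 - z\<^sup>2 \<in> S"
  shows "modulus_op (\<lambda>s. f (1 - s\<^sup>2)) z = 4 * z * param_op f (1 - z\<^sup>2)"
  using modulus_op_square[OF open_vimage_diff1[OF assms(1)] holomorphic_compose_diff1[OF assms(2)], of z]
    param_op_reflect[OF assms(1,2), of "z\<^sup>2"] assms(3) by simp

lemma modulus_wronskian_one_minus_square: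
  assumes "open S" "f holomorphic_on S" "g holomorphic_on S" "1 - z\<^sup>2 \<in> S"
  shows "modulus_wronskian (\<lambda>s. f (1 - s\<^sup>2)) (\<lambda>s. g (1 - s\<^sup>2)) z = - 2 * param_wronskian f g (1 - z\<^sup>2)"
  using modulus_wronskian_square[OF open_vimage_diff1[OF assms(1)]
      holomorphic_compose_diff1[OF assms(2)] holomorphic_compose_diff1[OF assms(3)], of z]
    param_wronskian_reflect[OF assms(1-3), of "z\<^sup>2"] assms(4) by simp

section \<open>The equation of the elliptic integral and its Wronskian with the reflected
  one\<close>

lemma holomorphic_on_ellK: "ellK holomorphic_on ball 0 1"
  by (rule power_series_holomorphic[where a = "\<lambda>n. of_real (pi/2) * (pochhammer (1/2) n / fact n)\<^sup>2"])
     (use ellK_sums in \<open>simp del: of_real_divide\<close>)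

text \<open>The Euler operator \<open>z d/dz\<close> multiplies the n-th coefficient by
  \<open>n\<close>; in terms of it a hypergeometric recurrence becomes a differential
  equation.\<close>

lemma sums_euler_operator:
  fixes f :: "complex \<Rightarrow> complex"
  assumes f: "\<And>z. norm z < 1 \<Longrightarrow> (\<lambda>n. c n * z ^ n) sums f z" and z: "norm z < 1"
  shows "(\<lambda>n. of_nat n * c n * z ^ n) sums (z * deriv f z)"
proof -
  have "f holomorphic_on ball 0 1"
    by (rule power_series_holomorphic) (use f in auto)
  then have "(f has_field_derivative deriv f z) (at z)"
    using z by (intro holomorphic_derivI[OF _ open_ball]) auto
  then have "(\<lambda>n. diffs c n * z ^ n) sums deriv f z"
    by (rule termdiffs_sums_strong[where K = 1, rotated]) (use f z in auto)
  then have "(\<lambda>n. z * (diffs c n * z ^ n)) sums (z * deriv f z)"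
    by (rule sums_mult)
  then have "(\<lambda>n. of_nat (Suc n) * c (Suc n) * z ^ Suc n) sums (z * deriv f z)"
    by (simp add: diffs_def mult_ac)
  \<comment> \<open>Only the term of index 0 is missing, and it vanishes because of the factor
    \<open>n\<close>.\<close>
  then show ?thesis
    by (subst (asm) sums_Suc_iff) simp
qed

text \<open>The coefficients satisfy \<open>(n + 1)^2 c (n + 1) = (n + 1/2)^2 c n\<close>. With
  \<open>E = z d/dz\<close> this says \<open>E^2 K = z (E + 1/2)^2 K\<close>, and the difference of
  the two sides is \<open>z * param_op ellK z\<close>.\<close>

lemma param_op_ellK:
  assumes z: "norm z < 1" "z \<noteq> 0"
  shows "param_op ellK z = 0"
proof -
  define c :: "nat \<Rightarrow> complex" where "c n = of_real (pi/2) * (pochhammer (1/2) n / fact n)\<^sup>2" for n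
  have c: "of_nat (Suc n) ^ 2 * c (Suc n) = (of_nat n + 1/2)\<^sup>2 * c n" for n
  proof -
    have "of_nat (Suc n) * (pochhammer (1/2) (Suc n) / fact (Suc n)) =
        (of_nat n + 1/2) * (pochhammer (1/2) n / (fact n :: complex))"
      by (simp add: pochhammer_rec' add.commute del: of_nat_Suc)
    then have "(of_nat (Suc n) * (pochhammer (1/2) (Suc n) / fact (Suc n)))\<^sup>2 =
        ((of_nat n + 1/2) * (pochhammer (1/2) n / (fact n :: complex)))\<^sup>2"
      by (rule arg_cong)
    then show ?thesis
      unfolding c_def by (simp only: power_mult_distrib mult_ac)
  qed
  define K1 where "K1 w = w * deriv ellK w" for w
  define K2 where "K2 w = w * deriv K1 w" for w
  have s0: "(\<lambda>n. c n * w ^ n) sums ellK w" if "norm w < 1" for w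
    using ellK_sums[OF that] by (simp add: c_def)
  have s1: "(\<lambda>n. of_nat n * c n * w ^ n) sums K1 w" if "norm w < 1" for w
    unfolding K1_def by (rule sums_euler_operator[OF s0 that])
  have s2: "(\<lambda>n. of_nat n * (of_nat n * c n) * w ^ n) sums K2 w" if "norm w < 1" for w
    unfolding K2_def by (rule sums_euler_operator[OF s1 that])
  have "(\<lambda>n. of_nat (Suc n) * (of_nat (Suc n) * c (Suc n)) * z ^ Suc n) sums K2 z"
    using s2[OF z(1)] by (subst sums_Suc_iff) simp
  moreover have "of_nat (Suc n) * (of_nat (Suc n) * c (Suc n)) * z ^ Suc n
      = z * (of_nat n * (of_nat n * c n) * z ^ n + of_nat n * c n * z ^ n + 1/4 * (c n * z ^ n))" for n
  proof -
    have "of_nat (Suc n) * (of_nat (Suc n) * c (Suc n)) * z ^ Suc n =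
        (of_nat n + 1/2)\<^sup>2 * c n * z ^ Suc n"
      using c[of n] by (simp add: power2_eq_square mult.assoc)
    then show ?thesis by (simp add: power2_eq_square algebra_simps)
  qed
  moreover have "(\<lambda>n. z * (of_nat n * (of_nat n * c n) * z ^ n + of_nat n * c n * z ^ n + 1/4 * (c n * z ^ n)))
      sums (z * (K2 z + K1 z + 1/4 * ellK z))"
    by (intro sums_mult sums_add s0 s1 s2 z)
  ultimately have eq: "K2 z = z * (K2 z + K1 z + 1/4 * ellK z)"
    by (simp only: sums_unique2)
  have "deriv ellK holomorphic_on ball 0 1"
    by (intro holomorphic_deriv holomorphic_on_ellK open_ball)
  then have "(deriv ellK has_field_derivative deriv (deriv ellK) z) (at z)"
    using z by (intro holomorphic_derivI[OF _ open_ball]) auto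
  then have "deriv K1 z = deriv ellK z + z * deriv (deriv ellK) z"
    unfolding K1_def by (intro DERIV_imp_deriv) (auto intro!: derivative_eq_intros)
  then have K2: "K2 z = z * (deriv ellK z + z * deriv (deriv ellK) z)"
    by (simp add: K2_def)
  have "z * param_op ellK z = 0"
    using eq unfolding param_op_eq K2 K1_def by (simp add: algebra_simps)
  then show ?thesis using z by simp
qed

text \<open>All coefficients of the power series are positive, so at the positive point 1/2 the
  series and its image under the Euler operator have positive real part.\<close>

lemma ellK_half_nonzero: "ellK (1/2) \<noteq> 0" "deriv ellK (1/2) \<noteq> 0"
proof -
  define c where "c n = pi / 2 * (pochhammer (1/2) n / fact n)\<^sup>2" for n
  have c: "c n > 0" for n
    using pochhammer_pos[of "1/2::real" n] by (simp add: c_def)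
  have s: "(\<lambda>n. of_real (c n) * z ^ n) sums ellK z" if "norm z < 1" for z
    using ellK_sums[OF that] by (simp add: c_def flip: pochhammer_of_real)
  have h: "norm (1/2 :: complex) < 1" by simp
  have r: "(1/2 :: complex) ^ n = of_real ((1/2) ^ n)" for n
    by simp
  have "(\<lambda>n. c n * (1/2) ^ n) sums Re (ellK (1/2))"
    using sums_Re[OF s[OF h]] unfolding r by (simp only: Re_complex_of_real flip: of_real_mult)
  moreover have "c n * (1/2) ^ n > 0" for n
    using c[of n] by simp
  ultimately have "Re (ellK (1/2)) > 0"
    using suminf_pos[of "\<lambda>n. c n * (1/2) ^ n"] unfolding sums_iff by metis
  then show "ellK (1/2) \<noteq> 0" by auto
  have "(\<lambda>n. of_nat n * of_real (c n) * (1/2) ^ n) sums (1/2 * deriv ellK (1/2))"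
    by (rule sums_euler_operator[OF s h])
  moreover have "of_nat n * of_real (c n) * (1/2) ^ n = complex_of_real (real n * c n * (1/2) ^ n)" for n
    by simp
  ultimately have "(\<lambda>n. complex_of_real (real n * c n * (1/2) ^ n)) sums (1/2 * deriv ellK (1/2))"
    by (simp only:)
  from sums_Re[OF this] have "(\<lambda>n. real n * c n * (1/2) ^ n) sums Re (1/2 * deriv ellK (1/2))"
    by (simp only: Re_complex_of_real)
  moreover have "0 \<le> real n * c n * (1/2) ^ n" for n
    using c[of n] by simp
  \<comment> \<open>The term of index 0 is 0, so strict positivity comes from index 1.\<close>
  moreover have "0 < real 1 * c 1 * (1/2) ^ 1"
    using c[of 1] by simp
  ultimately have "Re (1/2 * deriv ellK (1/2)) > 0"
    using suminf_pos2[of "\<lambda>n. real n * c n * (1/2) ^ n" 1] unfolding sums_iff by metis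
  then show "deriv ellK (1/2) \<noteq> 0" by auto
qed

text \<open>Here the power series of \<open>K(m)\<close> and of \<open>K(1 - m)\<close> both
  converge. The set contains the interval from which the continuations in the parameter start and
  misses the singular points 0 and 1.\<close>

abbreviation "lens \<equiv> ball 0 1 \<inter> ball 1 1 :: complex set"

lemma holomorphic_ellK_reflect: "(\<lambda>m. ellK (1 - m)) holomorphic_on ball 1 1"
  using holomorphic_compose_diff1[OF holomorphic_on_ellK]
  by (rule holomorphic_on_subset) (auto simp: dist_norm norm_minus_commute)

lemma param_op_ellK_reflect:
  assumes "norm (1 - z) < 1" "z \<noteq> 1"
  shows "param_op (\<lambda>m. ellK (1 - m)) z = 0"
  using param_op_reflect[OF open_ball holomorphic_on_ellK, of z] param_op_ellK[of "1 - z"] assms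
  by simp

text \<open>The Wronskian is constant on the connected set \<open>lens\<close>. At 1/2 the two
  functions agree and their derivatives are opposite, so only a product of \<open>K(1/2)\<close> and
  \<open>K'(1/2)\<close> remains.\<close>

lemma param_wronskian_ellK:
  assumes "z \<in> lens"
  shows "param_wronskian ellK (\<lambda>m. ellK (1 - m)) z \<noteq> 0"
proof -
  have "param_wronskian ellK (\<lambda>m. ellK (1 - m)) z = param_wronskian ellK (\<lambda>m. ellK (1 - m)) (1/2)"
  proof (rule wronskian_constant[where S = lens and q = "\<lambda>_. 1/4"])
    show "connected lens" by (intro convex_connected convex_Int convex_ball)
    show "ellK holomorphic_on lens" "(\<lambda>m. ellK (1 - m)) holomorphic_on lens"
      using holomorphic_on_ellK holomorphic_ellK_reflect by (auto intro: holomorphic_on_subset)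
    fix w assume "w \<in> lens"
    then have "norm w < 1" "norm (1 - w) < 1" "w \<noteq> 0" "w \<noteq> 1" by (auto simp: dist_norm)
    then show "param_op ellK w = 0" "param_op (\<lambda>m. ellK (1 - m)) w = 0"
      by (simp_all add: param_op_ellK param_op_ellK_reflect)
  qed (use assms in \<open>auto intro!: holomorphic_intros simp: dist_norm\<close>)
  also have "\<dots> = - (1/2) * ellK (1/2) * deriv ellK (1/2)"
    by (simp add: wronskian_def deriv_compose_diff1[OF open_ball holomorphic_on_ellK])
  also have "\<dots> \<noteq> 0" using ellK_half_nonzero by simp
  finally show ?thesis .
qed

section \<open>Continued branches remain solutions independent of the single-valued one\<close>

lemma continues_along_analytic:
  assumes "continues_along \<gamma> f g"
  shows "g analytic_on {pathfinish \<gamma>}"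
proof -
  from assms obtain h :: "real \<Rightarrow> complex \<Rightarrow> complex"
    where h: "\<forall>t\<in>{0..1}. h t analytic_on {\<gamma> t}"
      and ev: "\<forall>\<^sub>F z in nhds (pathfinish \<gamma>). h 1 z = g z"
    unfolding continues_along_def by blast
  from h have "h 1 analytic_on {pathfinish \<gamma>}"
    by (simp add: pathfinish_def)
  then show ?thesis
    by (rule analytic_at_cong[THEN iffD1, OF ev refl])
qed

text \<open>\<open>k\<close> solves the equation on all of \<open>P\<close>, so it is the same
  function along the whole path, and its Wronskian with the continued germ keeps the initial value.
  Both claims are instances of \<open>continues_along_permanence\<close>.\<close>

lemma continues_along_ode:
  assumes cont: "continues_along \<gamma> f g" and P: "open P" "path_image \<gamma> \<subseteq> P"
    and hol: "p holomorphic_on P" "q holomorphic_on P" "k holomorphic_on P"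
    and S: "open S" "pathstart \<gamma> \<in> S" "S \<subseteq> P" "f holomorphic_on S"
    and k: "\<And>z. z \<in> P \<Longrightarrow> sl_op p q k z = 0"
    and f: "\<And>z. z \<in> S \<Longrightarrow> sl_op p q f z = 0"
    and W: "wronskian p k f (pathstart \<gamma>) \<noteq> 0"
  shows "\<forall>\<^sub>F z in nhds (pathfinish \<gamma>). sl_op p q g z = 0"
    and "wronskian p k g (pathfinish \<gamma>) \<noteq> 0"
proof -
  show "\<forall>\<^sub>F z in nhds (pathfinish \<gamma>). sl_op p q g z = 0"
  proof (rule continues_along_permanence[OF cont P])
    show "\<forall>\<^sub>F z in nhds (pathstart \<gamma>). sl_op p q f z = 0"
      unfolding eventually_nhds using S(1,2) f by blast
    fix T :: "complex set" and h assume T: "open T" "T \<subseteq> P" "h holomorphic_on T"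
    show "sl_op p q h holomorphic_on T"
      by (intro holomorphic_sl_op T hol[THEN holomorphic_on_subset])
  qed (rule sl_op_cong)
  obtain r where r: "r > 0" "ball (pathstart \<gamma>) r \<subseteq> S"
    using S openE by blast
  let ?c = "wronskian p k f (pathstart \<gamma>)"
  \<comment> \<open>Nonvanishing does not have the form \<open>D g = 0\<close>, but constancy has:
    \<open>D h\<close> is the Wronskian of \<open>k\<close> and \<open>h\<close> minus its value at
    the start.\<close>
  have "\<forall>\<^sub>F z in nhds (pathfinish \<gamma>). wronskian p k g z - ?c = 0"
  proof (rule continues_along_permanence[OF cont P])
    have rP: "ball (pathstart \<gamma>) r \<subseteq> P" using r S by blast
    have "wronskian p k f z = ?c" if "z \<in> ball (pathstart \<gamma>) r" for z
    proof (rule wronskian_constant[where S = "ball (pathstart \<gamma>) r" and q = q])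
      fix w assume "w \<in> ball (pathstart \<gamma>) r"
      then show "sl_op p q k w = 0" "sl_op p q f w = 0" using rP r k f by blast+
    qed (use that r in \<open>simp_all add: hol[THEN holomorphic_on_subset] rP holomorphic_on_subset[OF S(4)]\<close>)
    moreover have "\<forall>\<^sub>F z in nhds (pathstart \<gamma>). z \<in> ball (pathstart \<gamma>) r"
      using r(1) by (intro eventually_nhds_in_open) auto
    ultimately show "\<forall>\<^sub>F z in nhds (pathstart \<gamma>). wronskian p k f z - ?c = 0"
      by (elim eventually_mono) (simp only: right_minus_eq)
  next
    fix T :: "complex set" and h assume T: "open T" "T \<subseteq> P" "h holomorphic_on T"
    show "(\<lambda>z. wronskian p k h z - ?c) holomorphic_on T"
      by (intro holomorphic_on_diff holomorphic_wronskian holomorphic_on_const T hol[THEN holomorphic_on_subset])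
  next
    fix T :: "complex set" and h h' :: "complex \<Rightarrow> complex" and z
    assume "open T" "\<And>z. z \<in> T \<Longrightarrow> h z = h' z" "z \<in> T"
    then show "wronskian p k h z - ?c = wronskian p k h' z - ?c"
      using wronskian_cong by metis
  qed
  then show "wronskian p k g (pathfinish \<gamma>) \<noteq> 0"
    using W by (auto dest: eventually_nhds_x_imp_x)
qed

lemma open_punctured_disc: "open {s::complex. 0 < norm s \<and> norm s < 1}"
  by (intro open_Collect_conj open_Collect_less continuous_intros)

text \<open>The single-valued partner is \<open>ellK\<close>, a solution on the whole punctured
  disc; \<open>lens\<close> is the neighbourhood of the starting point on which the initial germ is
  a power series.\<close>

lemma branch_param:
  assumes cont: "continues_along \<gamma> (\<lambda>w. ellK (1 - w)) g"
    and start: "pathstart \<gamma> \<in> of_real ` {0<..<1}"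
    and im: "path_image \<gamma> \<subseteq> {s. 0 < norm s \<and> norm s < 1}"
  shows "\<forall>\<^sub>F z in nhds (pathfinish \<gamma>). param_op g z = 0"
    and "param_wronskian ellK g (pathfinish \<gamma>) \<noteq> 0"
proof -
  have lens: "pathstart \<gamma> \<in> lens"
  proof -
    obtain x :: real where "0 < x" "x < 1" "pathstart \<gamma> = of_real x" using start by auto
    moreover have "norm (1 - of_real x :: complex) = norm (1 - x)"
      by (metis norm_of_real of_real_1 of_real_diff real_norm_def)
    ultimately show ?thesis by (simp add: dist_norm)
  qed
  have sub: "lens \<subseteq> {s. 0 < norm s \<and> norm s < 1}" by (auto simp: dist_norm)
  have *: "ellK holomorphic_on {s. 0 < norm s \<and> norm s < 1}"
    using holomorphic_on_ellK by (rule holomorphic_on_subset) auto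
  have **: "(\<lambda>m. ellK (1 - m)) holomorphic_on lens"
    using holomorphic_ellK_reflect by (rule holomorphic_on_subset) auto
  have ***: "open lens" by auto
  note ode = continues_along_ode[where p = "\<lambda>m. m * (1 - m)" and q = "\<lambda>_. 1/4",
      OF cont open_punctured_disc im _ _ * *** lens sub ** _ _ param_wronskian_ellK[OF lens]]
  have o: "param_op ellK z = 0" if "z \<in> {s. 0 < norm s \<and> norm s < 1}" for z
    using that by (auto intro: param_op_ellK)
  have o': "param_op (\<lambda>m. ellK (1 - m)) z = 0" if "z \<in> lens" for z
    using that by (intro param_op_ellK_reflect) (auto simp: dist_norm)
  have h: "(\<lambda>m. m * (1 - m)) holomorphic_on A" "(\<lambda>_. 1/4) holomorphic_on A" for A :: "complex set"
    by (intro holomorphic_intros)+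
  show "\<forall>\<^sub>F z in nhds (pathfinish \<gamma>). param_op g z = 0"
    by (rule ode(1)[OF h o o'])
  show "param_wronskian ellK g (pathfinish \<gamma>) \<noteq> 0"
    by (rule ode(2)[OF h o o'])
qed

lemma holomorphic_ellK_one_minus_square:
  "(\<lambda>t. ellK (1 - t\<^sup>2)) holomorphic_on {t. norm (1 - t\<^sup>2) < 1}"
  using holomorphic_compose_square[OF holomorphic_ellK_reflect] by (simp add: dist_norm)

lemma norm_square_less_one: "norm (z\<^sup>2) < 1 \<longleftrightarrow> norm z < 1" for z :: complex
  unfolding norm_power using abs_square_less_1[of "norm z"] by simp

lemma holomorphic_ellK_square: "(\<lambda>s. ellK (s\<^sup>2)) holomorphic_on ball 0 1"
proof (rule holomorphic_on_subset[OF holomorphic_compose_square[OF holomorphic_on_ellK]], rule subsetI)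
  fix z :: complex assume "z \<in> ball 0 1"
  then have "norm (z\<^sup>2) < 1" by (simp add: norm_square_less_one)
  then show "z \<in> {z. z\<^sup>2 \<in> ball 0 1}" by simp
qed

lemma modulus_op_ellK_square:
  assumes "norm z < 1" "z \<noteq> 0"
  shows "modulus_op (\<lambda>s. ellK (s\<^sup>2)) z = 0"
proof -
  have z: "norm (z\<^sup>2) < 1" "z\<^sup>2 \<noteq> 0"
    using assms by (blast intro: norm_square_less_one[THEN iffD2], simp)
  then have "modulus_op (\<lambda>s. ellK (s\<^sup>2)) z = 4 * z * param_op ellK (z\<^sup>2)"
    by (intro modulus_op_square[OF open_ball holomorphic_on_ellK]) simp
  also have "param_op ellK (z\<^sup>2) = 0"
    by (rule param_op_ellK[OF z])
  finally show ?thesis by simp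
qed

lemma modulus_op_ellK_one_minus_square:
  assumes "norm (1 - z\<^sup>2) < 1" "z\<^sup>2 \<noteq> 1"
  shows "modulus_op (\<lambda>s. ellK (1 - s\<^sup>2)) z = 0"
proof -
  have "modulus_op (\<lambda>s. ellK (1 - s\<^sup>2)) z = 4 * z * param_op ellK (1 - z\<^sup>2)"
    by (rule modulus_op_one_minus_square[OF open_ball holomorphic_on_ellK]) (use assms(1) in simp)
  also have "param_op ellK (1 - z\<^sup>2) = 0"
    by (rule param_op_ellK) (use assms in simp_all)
  finally show ?thesis by simp
qed

text \<open>The continuation of \<open>K(1 - s^2)\<close> runs in the modulus \<open>s\<close>, that
  of \<open>branch_param\<close> in the parameter. So the argument is made again with
  \<open>K(s^2)\<close> as the single-valued partner and the preimage of \<open>lens\<close> under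
  squaring as the starting neighbourhood.\<close>

lemma branch_modulus:
  assumes cont: "continues_along \<gamma> (\<lambda>s. ellK (1 - s\<^sup>2)) g"
    and start: "pathstart \<gamma> \<in> of_real ` {0<..<1}"
    and im: "path_image \<gamma> \<subseteq> {s. 0 < norm s \<and> norm s < 1}"
  shows "\<forall>\<^sub>F z in nhds (pathfinish \<gamma>). modulus_op g z = 0"
    and "modulus_wronskian (\<lambda>s. ellK (s\<^sup>2)) g (pathfinish \<gamma>) \<noteq> 0"
proof -
  define S where "S = {z::complex. z\<^sup>2 \<in> lens}"
  have S: "open S" unfolding S_def by (intro open_vimage_square) auto
  obtain x :: real where x: "0 < x" "x < 1" "pathstart \<gamma> = of_real x" using start by auto
  have "norm (1 - (of_real x)\<^sup>2 :: complex) = norm (1 - x\<^sup>2)"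
    by (metis norm_of_real of_real_1 of_real_diff of_real_power real_norm_def)
  also have "\<dots> < 1"
  proof -
    have "0 < x\<^sup>2" "x\<^sup>2 < 1" using x by (simp_all add: power_less_one_iff)
    then show ?thesis by simp
  qed
  finally have start: "pathstart \<gamma> \<in> S"
    using x by (simp add: S_def dist_norm norm_power power_less_one_iff)
  have sub: "S \<subseteq> {s. 0 < norm s \<and> norm s < 1}"
    by (auto simp: S_def dist_norm norm_power power_less_one_iff)
  have *: "(\<lambda>s. ellK (s\<^sup>2)) holomorphic_on {s. 0 < norm s \<and> norm s < 1}"
    using holomorphic_ellK_square by (rule holomorphic_on_subset) auto
  have refl: "(\<lambda>m. ellK (1 - m)) holomorphic_on lens"
    using holomorphic_ellK_reflect by (rule holomorphic_on_subset) auto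
  have **: "(\<lambda>s. ellK (1 - s\<^sup>2)) holomorphic_on S"
    using holomorphic_compose_square[OF refl] by (simp add: S_def)
  have "modulus_wronskian (\<lambda>s. ellK (s\<^sup>2)) (\<lambda>s. ellK (1 - s\<^sup>2)) (pathstart \<gamma>)
      = 2 * param_wronskian ellK (\<lambda>m. ellK (1 - m)) ((pathstart \<gamma>)\<^sup>2)"
    using start refl holomorphic_on_subset[OF holomorphic_on_ellK, of lens]
    by (intro modulus_wronskian_square[of lens]) (auto simp: S_def)
  then have W: "modulus_wronskian (\<lambda>s. ellK (s\<^sup>2)) (\<lambda>s. ellK (1 - s\<^sup>2)) (pathstart \<gamma>) \<noteq> 0"
    using start param_wronskian_ellK by (simp add: S_def)
  note ode = continues_along_ode[where p = "\<lambda>s. s * (1 - s\<^sup>2)" and q = "\<lambda>s. s",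
      OF cont open_punctured_disc im _ _ * S start sub ** _ _ W]
  have o: "modulus_op (\<lambda>s. ellK (s\<^sup>2)) z = 0" if "z \<in> {s. 0 < norm s \<and> norm s < 1}" for z
    using that by (intro modulus_op_ellK_square) simp_all
  have o': "modulus_op (\<lambda>s. ellK (1 - s\<^sup>2)) z = 0" if "z \<in> S" for z
  proof (rule modulus_op_ellK_one_minus_square)
    show "norm (1 - z\<^sup>2) < 1" "z\<^sup>2 \<noteq> 1" using that by (auto simp: S_def dist_norm)
  qed
  have h: "(\<lambda>s. s * (1 - s\<^sup>2)) holomorphic_on A" "(\<lambda>s. s) holomorphic_on A" for A :: "complex set"
    by (intro holomorphic_intros)+
  show "\<forall>\<^sub>F z in nhds (pathfinish \<gamma>). modulus_op g z = 0"
    by (rule ode(1)[OF h o o'])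
  show "modulus_wronskian (\<lambda>s. ellK (s\<^sup>2)) g (pathfinish \<gamma>) \<noteq> 0"
    by (rule ode(2)[OF h o o'])
qed

section \<open>Separation of variables\<close>

text \<open>Here \<open>(x, y)\<close> is the point with coordinates \<open>(a, b)\<close>, the other constants are the first and
  second derivatives of \<open>x\<close> and \<open>y\<close> with respect to \<open>a\<close>, and the six identities compare the
  coefficients of \<open>F\<^sub>x\<^sub>x\<close>, \<open>F\<^sub>x\<^sub>y\<close>, \<open>F\<^sub>y\<^sub>y\<close>, \<open>F\<^sub>x\<close>, \<open>F\<^sub>y\<close>, \<open>F\<close> in \<open>L\<^sub>a (F / (a + b)) = e\<^sub>1 S\<^sub>1 + e\<^sub>2 S\<^sub>2\<close>.\<close>

lemma appell_coefficients:
  fixes a b r :: complex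
  assumes r: "(a + b) * r = 1"
  defines "x \<equiv> 4 * a * b * r^2" and "y \<equiv> - ((1 - a^2) * (1 - b^2) * r^2)"
    and "xa \<equiv> 4 * b * (b - a) * r^3" and "ya \<equiv> 2 * (1 - b^2) * (1 + a * b) * r^3"
    and "xaa \<equiv> 8 * b * (a - 2 * b) * r^4" and "yaa \<equiv> 2 * (1 - b^2) * (b^2 - 2 * a * b - 3) * r^4"
    and "e1 \<equiv> 4 * b * (1 - a^2) * r^3" and "e2 \<equiv> - (4 * a * (1 - b^2) * r^3)"
    and "P \<equiv> a * (1 - a^2)"
  shows "P * xa^2 * r = e1 * (x * (1 - x))" "P * (2 * xa * ya) * r = - (e1 + e2) * (x * y)"
    "P * ya^2 * r = e2 * (y * (1 - y))"
    "P * (xaa * r - 2 * xa * r^2) + (1 - 3 * a^2) * xa * r = e1 * (1 - 2 * x) - 1/2 * e2 * x"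
    "P * (yaa * r - 2 * ya * r^2) + (1 - 3 * a^2) * ya * r = e2 * (1 - 2 * y) - 1/2 * e1 * y"
    "P * (2 * r^3) - (1 - 3 * a^2) * r^2 - a * r = - 1/4 * (e1 + e2)"
proof -
  \<comment> \<open>In these coordinates \<open>1 - x\<close> and \<open>1 - y\<close> are squares,
    which is how \<open>xa^2\<close> and \<open>ya^2\<close> match the leading coefficients of (S).
    With \<open>r\<close> for \<open>1 / (a + b)\<close> every identity is polynomial.\<close>
  have x1: "1 - x = (a - b)^2 * r^2" and y1: "1 - y = (1 + a * b)^2 * r^2"
    unfolding x_def y_def using r by algebra+
  show "P * xa^2 * r = e1 * (x * (1 - x))"
    unfolding x1 unfolding P_def xa_def e1_def x_def by algebra
  show "P * (2 * xa * ya) * r = - (e1 + e2) * (x * y)"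
    unfolding P_def xa_def ya_def e1_def e2_def x_def y_def by algebra
  show "P * ya^2 * r = e2 * (y * (1 - y))"
    unfolding y1 unfolding P_def ya_def e2_def y_def by algebra
  show "P * (xaa * r - 2 * xa * r^2) + (1 - 3 * a^2) * xa * r = e1 * (1 - 2 * x) - 1/2 * e2 * x"
    unfolding P_def xaa_def xa_def e1_def e2_def x_def using r by algebra
  show "P * (yaa * r - 2 * ya * r^2) + (1 - 3 * a^2) * ya * r = e2 * (1 - 2 * y) - 1/2 * e1 * y"
    unfolding P_def yaa_def ya_def e1_def e2_def y_def using r by algebra
  show "P * (2 * r^3) - (1 - 3 * a^2) * r^2 - a * r = - 1/4 * (e1 + e2)"
    unfolding P_def e1_def e2_def using r by algebra
qed

section \<open>The Appell operators in the modulus coordinates\<close>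

definition appell1 :: "(complex \<times> complex \<Rightarrow> complex) \<Rightarrow> complex \<times> complex \<Rightarrow> complex" where
  "appell1 F = (\<lambda>(x, y). x * (1 - x) * pdx (pdx F) (x, y) - x * y * pdx (pdy F) (x, y)
       + (1 - 2 * x) * pdx F (x, y) - 1/2 * y * pdy F (x, y) - 1/4 * F (x, y))"

definition appell2 :: "(complex \<times> complex \<Rightarrow> complex) \<Rightarrow> complex \<times> complex \<Rightarrow> complex" where
  "appell2 F = (\<lambda>(x, y). y * (1 - y) * pdy (pdy F) (x, y) - x * y * pdx (pdy F) (x, y)
       + (1 - 2 * y) * pdy F (x, y) - 1/2 * x * pdx F (x, y) - 1/4 * F (x, y))"

lemma system_S_iff: "system_S F x y \<longleftrightarrow> appell1 F (x, y) = 0 \<and> appell2 F (x, y) = 0"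
  by (simp add: system_S_def appell1_def appell2_def)

definition modulus_map :: "complex \<Rightarrow> complex \<Rightarrow> complex \<times> complex" where
  "modulus_map a b = (4 * a * b / (a + b)\<^sup>2, - ((1 - a\<^sup>2) * (1 - b\<^sup>2)) / (a + b)\<^sup>2)"

text \<open>This symmetry carries every statement about the first coordinate over to the
  second.\<close>

lemma modulus_map_commute: "modulus_map a b = modulus_map b a"
  by (simp add: modulus_map_def mult_ac add.commute)

lemma has_field_derivative_compose2:
  assumes "F holomorphic2_on V" "open V" "(f z, g z) \<in> V"
    and f: "(f has_field_derivative f') (at z)" and g: "(g has_field_derivative g') (at z)"
  shows "((\<lambda>s. F (f s, g s)) has_field_derivative pdx F (f z, g z) * f' + pdy F (f z, g z) * g') (at z)"
proof -
  have "((\<lambda>s. (f s, g s)) has_derivative (\<lambda>h. (f' * h, g' * h))) (at z)"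
    using f g unfolding has_field_derivative_def by (rule has_derivative_Pair)
  from has_derivative_compose[OF this has_derivative_holomorphic2[OF assms(1-3)]]
  show ?thesis
    unfolding has_field_derivative_def
    by (rule has_derivative_eq_rhs) (simp add: fun_eq_iff algebra_simps)
qed

text \<open>Division by \<open>s + b\<close> strips the prefactor that the periods share. The chain
  rule, applied twice, writes the left side through \<open>F\<close> and its derivatives up to order
  two, with the six coefficients computed in \<open>appell_coefficients\<close>.\<close>

lemma modulus_op_pullback:
  assumes V: "open V" and F: "F holomorphic2_on V"
    and ab: "modulus_map a b \<in> V" "a + b \<noteq> 0"
  shows "modulus_op (\<lambda>s. F (modulus_map s b) / (s + b)) a =
    4 * b * (1 - a\<^sup>2) / (a + b)^3 * appell1 F (modulus_map a b)
      - 4 * a * (1 - b\<^sup>2) / (a + b)^3 * appell2 F (modulus_map a b)"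
proof -
  define r where "r s = inverse (s + b)" for s
  define X where "X s = 4 * s * b * r s ^ 2" for s
  define Y where "Y s = - ((1 - s^2) * (1 - b^2) * r s ^ 2)" for s
  \<comment> \<open>The first and second derivatives of \<open>X\<close> and \<open>Y\<close>,
    reduced by \<open>(s + b) * r s = 1\<close> to the shape used in
    \<open>appell_coefficients\<close>.\<close>
  define Xa where "Xa s = 4 * b * (b - s) * r s ^ 3" for s
  define Ya where "Ya s = 2 * (1 - b^2) * (1 + s * b) * r s ^ 3" for s
  define Xaa where "Xaa s = 8 * b * (s - 2 * b) * r s ^ 4" for s
  define Yaa where "Yaa s = 2 * (1 - b^2) * (b^2 - 2 * s * b - 3) * r s ^ 4" for s
  have map: "modulus_map s b = (X s, Y s)" for s
    by (simp add: modulus_map_def X_def Y_def r_def divide_inverse power_inverse)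
  have r: "(s + b) * r s = 1" if "s + b \<noteq> 0" for s
    using that by (simp add: r_def)
  have Dr: "(r has_field_derivative - (r s ^ 2)) (at s)" if "s + b \<noteq> 0" for s
    unfolding r_def using that
    by (auto intro!: derivative_eq_intros simp: power2_eq_square)
  note D = derivative_eq_intros Dr refl
  have DX: "(X has_field_derivative Xa s) (at s)" if s: "s + b \<noteq> 0" for s
  proof -
    have "(X has_field_derivative 4 * b * r s ^ 2 + 4 * s * b * (2 * r s * - (r s ^ 2))) (at s)"
      unfolding X_def by (auto intro!: D simp: s)
    also have "4 * b * r s ^ 2 + 4 * s * b * (2 * r s * - (r s ^ 2)) = Xa s"
      unfolding Xa_def using r[OF s] by algebra
    finally show ?thesis .
  qed
  have DY: "(Y has_field_derivative Ya s) (at s)" if s: "s + b \<noteq> 0" for s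
  proof -
    have "(Y has_field_derivative 2 * s * (1 - b^2) * r s ^ 2
        - (1 - s^2) * (1 - b^2) * (2 * r s * - (r s ^ 2))) (at s)"
      unfolding Y_def by (auto intro!: D simp: s)
    also have "2 * s * (1 - b^2) * r s ^ 2 - (1 - s^2) * (1 - b^2) * (2 * r s * - (r s ^ 2)) = Ya s"
      unfolding Ya_def using r[OF s] by algebra
    finally show ?thesis .
  qed
  have DXa: "(Xa has_field_derivative Xaa s) (at s)" if s: "s + b \<noteq> 0" for s
  proof -
    have "(Xa has_field_derivative - (4 * b * r s ^ 3) + 4 * b * (b - s) * (3 * r s ^ 2 * - (r s ^ 2))) (at s)"
      unfolding Xa_def by (auto intro!: D simp: s)
    also have "- (4 * b * r s ^ 3) + 4 * b * (b - s) * (3 * r s ^ 2 * - (r s ^ 2)) = Xaa s"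
      unfolding Xaa_def using r[OF s] by algebra
    finally show ?thesis .
  qed
  have DYa: "(Ya has_field_derivative Yaa s) (at s)" if s: "s + b \<noteq> 0" for s
  proof -
    have "(Ya has_field_derivative 2 * (1 - b^2) * b * r s ^ 3
        + 2 * (1 - b^2) * (1 + s * b) * (3 * r s ^ 2 * - (r s ^ 2))) (at s)"
      unfolding Ya_def by (auto intro!: D simp: s)
    also have "2 * (1 - b^2) * b * r s ^ 3 + 2 * (1 - b^2) * (1 + s * b) * (3 * r s ^ 2 * - (r s ^ 2)) = Yaa s"
      unfolding Yaa_def using r[OF s] by algebra
    finally show ?thesis .
  qed
  have comp: "((\<lambda>s. H (X s, Y s)) has_field_derivative
      pdx H (X s, Y s) * Xa s + pdy H (X s, Y s) * Ya s) (at s)"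
    if "H holomorphic2_on V" "(X s, Y s) \<in> V" "s + b \<noteq> 0" for H s
    using that by (intro has_field_derivative_compose2[OF _ V] DX DY)
  \<comment> \<open>Open, so that the formula \<open>G1\<close> for the first derivative holds near
    \<open>a\<close> and can be differentiated again.\<close>
  define T where "T = {s. s + b \<noteq> 0} \<inter> (\<lambda>s. (X s, Y s)) -` V"
  have "open T" unfolding T_def
  proof (rule continuous_open_preimage)
    show "continuous_on {s. s + b \<noteq> 0} (\<lambda>s. (X s, Y s))"
      using DX DY by (intro continuous_on_Pair continuous_at_imp_continuous_on) (auto dest: DERIV_isCont)
    show "open {s. s + b \<noteq> 0}"
      by (intro open_Collect_neq continuous_intros)
  qed (rule V)
  have aT: "a \<in> T" using ab by (simp add: T_def map)
  let ?G = "\<lambda>s. F (modulus_map s b) / (s + b)"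
  define G1 where "G1 s = (pdx F (X s, Y s) * Xa s + pdy F (X s, Y s) * Ya s) * r s
      + F (X s, Y s) * - (r s ^ 2)" for s
  have DG: "deriv ?G s = G1 s" if "s \<in> T" for s
  proof (rule DERIV_imp_deriv)
    have s: "s + b \<noteq> 0" "(X s, Y s) \<in> V" using that by (auto simp: T_def)
    have "((\<lambda>s. F (X s, Y s) * r s) has_field_derivative G1 s) (at s)"
      unfolding G1_def using DERIV_mult[OF comp[OF F s(2,1)] Dr[OF s(1)]] by (simp add: mult_ac)
    then show "(?G has_field_derivative G1 s) (at s)"
      by (simp add: map r_def divide_inverse)
  qed
  let ?x = "X a" and ?y = "Y a" and ?r = "r a"
  let ?p = "(X a, Y a)"
  define G2 where "G2 = (((pdx (pdx F) ?p * Xa a + pdx (pdy F) ?p * Ya a) * Xa a + pdx F ?p * Xaa a)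
      + ((pdx (pdy F) ?p * Xa a + pdy (pdy F) ?p * Ya a) * Ya a + pdy F ?p * Yaa a)) * ?r
      + (pdx F ?p * Xa a + pdy F ?p * Ya a) * - (?r ^ 2)
      + (pdx F ?p * Xa a + pdy F ?p * Ya a) * - (?r ^ 2) + F ?p * (2 * ?r ^ 3)"
  have DG2: "deriv (deriv ?G) a = G2"
  proof -
    have p: "?p \<in> V" using aT by (simp add: T_def)
    have a0: "a + b \<noteq> 0" by fact
    \<comment> \<open>Replacing \<open>pdy (pdx F)\<close> by \<open>pdx (pdy F)\<close> leaves a
      single mixed derivative, as in (S).\<close>
    note c = comp[OF F p a0] comp[OF holomorphic2_on_pdx[OF V F] p a0, unfolded pdy_pdx_eq_pdx_pdy[OF V F p]]
      comp[OF holomorphic2_on_pdy[OF V F] p a0]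
    have r2: "((\<lambda>s. - (r s ^ 2)) has_field_derivative 2 * ?r ^ 3) (at a)"
      by (auto intro!: D simp: a0 power2_eq_square power3_eq_cube)
    have "((\<lambda>s. (pdx F (X s, Y s) * Xa s + pdy F (X s, Y s) * Ya s) * r s
      + F (X s, Y s) * - (r s ^ 2)) has_field_derivative G2) (at a)"
      using DERIV_add[OF DERIV_mult[OF DERIV_add[OF DERIV_mult[OF c(2) DXa[OF a0]]
          DERIV_mult[OF c(3) DYa[OF a0]]] Dr[OF a0]] DERIV_mult[OF c(1) r2]]
      by (rule DERIV_cong) (simp add: G2_def algebra_simps)
    then have "deriv G1 a = G2"
      unfolding G1_def by (rule DERIV_imp_deriv)
    then show ?thesis
      using deriv_cong_open[OF \<open>open T\<close> DG aT] by simp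
  qed
  have G: "?G a = F ?p * ?r" by (simp add: map r_def divide_inverse)
  define e1 where "e1 = 4 * b * (1 - a^2) * ?r^3"
  define e2 where "e2 = - (4 * a * (1 - b^2) * ?r^3)"
  define P where "P = a * (1 - a^2)"
  note id = appell_coefficients[OF r[OF ab(2)], folded X_def Y_def Xa_def Ya_def Xaa_def Yaa_def,
      folded e1_def e2_def, folded P_def]
  have "modulus_op ?G a = P * G2 + (1 - 3 * a^2) * G1 a - a * (F ?p * ?r)"
    by (simp only: modulus_op_eq DG2 DG[OF aT] G P_def)
  also have "\<dots> = pdx (pdx F) ?p * (P * Xa a ^ 2 * ?r) + pdx (pdy F) ?p * (P * (2 * Xa a * Ya a) * ?r)
      + pdy (pdy F) ?p * (P * Ya a ^ 2 * ?r)
      + pdx F ?p * (P * (Xaa a * ?r - 2 * Xa a * ?r^2) + (1 - 3 * a^2) * Xa a * ?r)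
      + pdy F ?p * (P * (Yaa a * ?r - 2 * Ya a * ?r^2) + (1 - 3 * a^2) * Ya a * ?r)
      + F ?p * (P * (2 * ?r^3) - (1 - 3 * a^2) * ?r^2 - a * ?r)"
    by (simp add: G1_def G2_def algebra_simps power2_eq_square)
  also have "\<dots> = e1 * appell1 F ?p + e2 * appell2 F ?p"
    unfolding id by (simp add: appell1_def appell2_def algebra_simps)
  finally show ?thesis
    by (simp add: e1_def e2_def map r_def divide_inverse power_inverse)
qed

text \<open>Stated along an arbitrary curve because it serves both for lines with one modulus fixed
  and for the curves traced by the moduli when \<open>x\<close> or \<open>y\<close> varies alone.
  The factored form exhibits the Jacobian.\<close>

lemma modulus_map_derivatives:
  fixes f g :: "complex \<Rightarrow> complex"
  assumes f: "(f has_field_derivative f') (at z)" and g: "(g has_field_derivative g') (at z)"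
    and q: "f z + g z \<noteq> 0"
  defines "r \<equiv> inverse (f z + g z)"
  shows "((\<lambda>s. fst (modulus_map (f s) (g s))) has_field_derivative
      4 * r^3 * (g z - f z) * (g z * f' - f z * g')) (at z)"
    and "((\<lambda>s. snd (modulus_map (f s) (g s))) has_field_derivative
      2 * r^3 * (1 + f z * g z) * ((1 - (g z)\<^sup>2) * f' + (1 - (f z)\<^sup>2) * g')) (at z)"
proof -
  define a b where "a = f z" and "b = g z"
  have r: "(a + b) * r = 1" using q by (simp add: r_def a_def b_def)
  have Dr: "((\<lambda>s. inverse (f s + g s)) has_field_derivative - (r ^ 2 * (f' + g'))) (at z)"
    by (rule DERIV_cong, rule DERIV_inverse'[OF DERIV_add[OF f g] q])
       (simp add: r_def power2_eq_square mult_ac)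
  note D = derivative_eq_intros Dr f g refl
  have "((\<lambda>s. 4 * f s * g s * inverse (f s + g s) ^ 2) has_field_derivative
      (4 * f' * b + 4 * a * g') * r^2 + 4 * a * b * (2 * r * - (r ^ 2 * (f' + g')))) (at z)"
    by (rule D)+ (simp add: a_def b_def r_def algebra_simps)
  also have "(4 * f' * b + 4 * a * g') * r^2 + 4 * a * b * (2 * r * - (r ^ 2 * (f' + g')))
      = 4 * r^3 * (b - a) * (b * f' - a * g')"
    using r by algebra
  finally show "((\<lambda>s. fst (modulus_map (f s) (g s))) has_field_derivative
      4 * r^3 * (g z - f z) * (g z * f' - f z * g')) (at z)"
    by (simp add: modulus_map_def a_def b_def divide_inverse power_inverse)
  have "((\<lambda>s. - ((1 - f s ^ 2) * (1 - g s ^ 2)) * inverse (f s + g s) ^ 2) has_field_derivative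
      (2 * a * f' * (1 - b^2) + (1 - a^2) * (2 * b * g')) * r^2
        - (1 - a^2) * (1 - b^2) * (2 * r * - (r ^ 2 * (f' + g')))) (at z)"
    by (rule D)+ (simp add: a_def b_def r_def algebra_simps)
  also have "(2 * a * f' * (1 - b^2) + (1 - a^2) * (2 * b * g')) * r^2
        - (1 - a^2) * (1 - b^2) * (2 * r * - (r ^ 2 * (f' + g')))
      = 2 * r^3 * (1 + a * b) * ((1 - b^2) * f' + (1 - a^2) * g')"
    using r by algebra
  finally show "((\<lambda>s. snd (modulus_map (f s) (g s))) has_field_derivative
      2 * r^3 * (1 + f z * g z) * ((1 - (g z)\<^sup>2) * f' + (1 - (f z)\<^sup>2) * g')) (at z)"
    by (simp add: modulus_map_def a_def b_def divide_inverse power_inverse)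
qed

lemma field_differentiable_pullback:
  assumes V: "open V" and F: "F holomorphic2_on V"
    and ab: "modulus_map a b \<in> V" "a + b \<noteq> 0"
  shows "(\<lambda>s. F (modulus_map s b) / (s + b)) field_differentiable at a"
proof -
  have id: "((\<lambda>s. s) has_field_derivative 1) (at a)" by (rule DERIV_ident)
  have const: "((\<lambda>s. b) has_field_derivative 0) (at a)" by (rule DERIV_const)
  note d = modulus_map_derivatives[OF id const ab(2)]
  have "((\<lambda>s. F (fst (modulus_map s b), snd (modulus_map s b))) has_field_derivative
      pdx F (fst (modulus_map a b), snd (modulus_map a b)) *
        (4 * inverse (a + b) ^ 3 * (b - a) * (b * 1 - a * 0)) +
      pdy F (fst (modulus_map a b), snd (modulus_map a b)) *
        (2 * inverse (a + b) ^ 3 * (1 + a * b) * ((1 - b\<^sup>2) * 1 + (1 - a\<^sup>2) * 0))) (at a)"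
    using ab(1) by (intro has_field_derivative_compose2[OF F V _ d]) simp
  then have "(\<lambda>s. F (modulus_map s b)) field_differentiable at a"
    unfolding field_differentiable_def by auto
  then show ?thesis
    using ab(2) by (intro derivative_intros) auto
qed

text \<open>The separated operators are \<open>4 / (a + b)^3\<close> times the matrix with rows
  \<open>(u, - v)\<close> and \<open>(v, - u)\<close> applied to the left sides of (S). Its
  determinant is \<open>v^2 - u^2\<close>, and the Jacobian of \<open>modulus_map\<close> is
  \<open>8 / (a + b)^6\<close> times \<open>u^2 - v^2\<close>.\<close>

lemma system_S_pullback_iff:
  assumes V: "open V" and F: "F holomorphic2_on V"
    and ab: "modulus_map a b \<in> V" "a + b \<noteq> 0"
    and J: "(b - a) * (1 + a * b) * (1 - a * b) \<noteq> 0"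
  shows "system_S F (fst (modulus_map a b)) (snd (modulus_map a b)) \<longleftrightarrow>
    modulus_op (\<lambda>s. F (modulus_map s b) / (s + b)) a = 0 \<and>
    modulus_op (\<lambda>s. F (modulus_map a s) / (a + s)) b = 0"
proof -
  define u where "u = b * (1 - a\<^sup>2)"
  define v where "v = a * (1 - b\<^sup>2)"
  define S1 where "S1 = appell1 F (modulus_map a b)"
  define S2 where "S2 = appell2 F (modulus_map a b)"
  have uv: "u\<^sup>2 - v\<^sup>2 = (b - a) * (1 + a * b) * (1 - a * b) * (a + b)"
    unfolding u_def v_def by algebra
  have 1: "modulus_op (\<lambda>s. F (modulus_map s b) / (s + b)) a = 4 / (a + b)^3 * (u * S1 - v * S2)"
    unfolding modulus_op_pullback[OF V F ab] S1_def[symmetric] S2_def[symmetric] u_def v_def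
    by (simp add: divide_inverse algebra_simps)
  \<comment> \<open>The previous formula with \<open>a\<close> and \<open>b\<close> exchanged, which
    exchanges \<open>u\<close> and \<open>v\<close>.\<close>
  have "modulus_op (\<lambda>s. F (modulus_map s a) / (s + a)) b = 4 / (a + b)^3 * (v * S1 - u * S2)"
    using ab
    by (subst modulus_op_pullback[OF V F]) (simp_all add: modulus_map_commute[of b a] add.commute[of b a]
       S1_def[symmetric] S2_def[symmetric] u_def v_def divide_inverse algebra_simps)
  then have 2: "modulus_op (\<lambda>s. F (modulus_map a s) / (a + s)) b = 4 / (a + b)^3 * (v * S1 - u * S2)"
    by (simp only: modulus_map_commute[of a] add.commute[of a])
  have "S1 = 0 \<and> S2 = 0 \<longleftrightarrow> u * S1 - v * S2 = 0 \<and> v * S1 - u * S2 = 0"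
  proof (intro iffI conjI; (elim conjE)?)
    assume *: "u * S1 - v * S2 = 0" "v * S1 - u * S2 = 0"
    have "(u\<^sup>2 - v\<^sup>2) * S1 = 0" "(u\<^sup>2 - v\<^sup>2) * S2 = 0"
      using * by algebra+
    moreover have "u\<^sup>2 - v\<^sup>2 \<noteq> 0" using J ab(2) unfolding uv by simp
    ultimately show "S1 = 0" "S2 = 0" by simp_all
  qed simp_all
  then show ?thesis
    unfolding system_S_iff 1 2 using ab(2) by (simp add: S1_def S2_def)
qed

section \<open>The moduli as local coordinates off the axes\<close>

locale modulus_chart =
  fixes V :: "(complex \<times> complex) set" and L1 L2 :: "complex \<times> complex \<Rightarrow> complex"
  assumes open_V: "open V"
    and hol1: "L1 holomorphic2_on V" and hol2: "L2 holomorphic2_on V"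
    and sum_nonzero: "p \<in> V \<Longrightarrow> L1 p + L2 p \<noteq> 0"
    and map: "p \<in> V \<Longrightarrow> modulus_map (L1 p) (L2 p) = p"
    and coord_nonzero: "p \<in> V \<Longrightarrow> fst p \<noteq> 0" "p \<in> V \<Longrightarrow> snd p \<noteq> 0"
    and small: "p \<in> V \<Longrightarrow> norm (L1 p) < 1" "p \<in> V \<Longrightarrow> norm (1 - (L2 p)\<^sup>2) < 1"
begin

text \<open>Together with \<open>small\<close>, this and \<open>L2_square_neq_1\<close> keep both
  moduli away from 0, 1 and -1, the singular points of \<open>modulus_op\<close>.\<close>

lemma L1_nonzero: "p \<in> V \<Longrightarrow> L1 p \<noteq> 0"
  using map[of p] coord_nonzero(1)[of p] by (auto simp: modulus_map_def prod_eq_iff)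

lemma L2_square_neq_1: "p \<in> V \<Longrightarrow> (L2 p)\<^sup>2 \<noteq> 1"
  using map[of p] coord_nonzero(2)[of p] by (auto simp: modulus_map_def prod_eq_iff)

abbreviation chart :: "complex \<times> complex \<Rightarrow> complex \<times> complex" where
  "chart \<equiv> \<lambda>p. (L1 p, L2 p)"

text \<open>The chart is injective because \<open>modulus_map\<close> undoes it. Openness of images
  is what provides boxes on which the two moduli vary independently.\<close>

lemma open_chart_image:
  assumes "open N" "N \<subseteq> V"
  shows "open (chart ` N)"
proof (rule invariance_of_domain)
  show "continuous_on N chart"
    using assms by (intro continuous_on_Pair holomorphic2_on_imp_continuous_on
        holomorphic2_on_subset[OF hol1] holomorphic2_on_subset[OF hol2])
  show "inj_on chart N"
    using map assms by (intro inj_onI) (metis prod.inject subsetD)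
qed (rule assms)

text \<open>Differentiating \<open>map\<close> in \<open>x\<close> and in \<open>y\<close> shows
  that the Jacobian matrices of \<open>modulus_map\<close> and of the chart multiply to the
  identity.\<close>

lemma jacobian_nonzero:
  assumes p: "p \<in> V"
  shows "(L2 p - L1 p) * (1 + L1 p * L2 p) * (1 - L1 p * L2 p) \<noteq> 0"
proof -
  obtain x y where xy: "p = (x, y)" by (cases p)
  have pV: "(x, y) \<in> V" using p xy by simp
  define a where "a = L1 (x, y)"
  define b where "b = L2 (x, y)"
  define r where "r = inverse (a + b)"
  have q: "L1 (x, y) + L2 (x, y) \<noteq> 0" using sum_nonzero pV by blast
  obtain \<alpha> \<beta> \<gamma> \<delta> where
    X1: "((\<lambda>s. L1 (s, y)) has_field_derivative \<alpha>) (at x)" and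
    X2: "((\<lambda>s. L2 (s, y)) has_field_derivative \<beta>) (at x)" and
    Y1: "((\<lambda>s. L1 (x, s)) has_field_derivative \<gamma>) (at y)" and
    Y2: "((\<lambda>s. L2 (x, s)) has_field_derivative \<delta>) (at y)"
    using has_field_derivative_pdx[OF hol1 open_V pV] has_field_derivative_pdx[OF hol2 open_V pV]
      has_field_derivative_pdy[OF hol1 open_V pV] has_field_derivative_pdy[OF hol2 open_V pV] by blast
  have mx: "modulus_map (L1 (s, y)) (L2 (s, y)) = (s, y)" if "s \<in> {s. (s, y) \<in> V}" for s
    using map that by simp
  have my: "modulus_map (L1 (x, s)) (L2 (x, s)) = (x, s)" if "s \<in> {s. (x, s) \<in> V}" for s
    using map that by simp
  have o: "open {s. (s, y) \<in> V}" "open {s. (x, s) \<in> V}" by (intro open_slices open_V)+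
  have i: "x \<in> {s. (s, y) \<in> V}" "y \<in> {s. (x, s) \<in> V}" using pV by auto
  have "((\<lambda>s. s) has_field_derivative 4 * r^3 * (b - a) * (b * \<alpha> - a * \<beta>)) (at x)"
    by (rule has_field_derivative_transform_within_open[OF modulus_map_derivatives(1)[OF X1 X2 q,
          folded a_def b_def, folded r_def] o(1) i(1)]) (simp add: mx)
  from DERIV_unique[OF this DERIV_ident] have e1: "4 * r^3 * (b - a) * (b * \<alpha> - a * \<beta>) = 1" .
  have "((\<lambda>s. y) has_field_derivative 2 * r^3 * (1 + a * b) * ((1 - b\<^sup>2) * \<alpha> + (1 - a\<^sup>2) * \<beta>)) (at x)"
    by (rule has_field_derivative_transform_within_open[OF modulus_map_derivatives(2)[OF X1 X2 q,
          folded a_def b_def, folded r_def] o(1) i(1)]) (simp add: mx)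
  from DERIV_unique[OF this DERIV_const]
  have e2: "2 * r^3 * (1 + a * b) * ((1 - b\<^sup>2) * \<alpha> + (1 - a\<^sup>2) * \<beta>) = 0" .
  have "((\<lambda>s. x) has_field_derivative 4 * r^3 * (b - a) * (b * \<gamma> - a * \<delta>)) (at y)"
    by (rule has_field_derivative_transform_within_open[OF modulus_map_derivatives(1)[OF Y1 Y2 q,
          folded a_def b_def, folded r_def] o(2) i(2)]) (simp add: my)
  from DERIV_unique[OF this DERIV_const] have e3: "4 * r^3 * (b - a) * (b * \<gamma> - a * \<delta>) = 0" .
  have "((\<lambda>s. s) has_field_derivative 2 * r^3 * (1 + a * b) * ((1 - b\<^sup>2) * \<gamma> + (1 - a\<^sup>2) * \<delta>)) (at y)"
    by (rule has_field_derivative_transform_within_open[OF modulus_map_derivatives(2)[OF Y1 Y2 q,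
          folded a_def b_def, folded r_def] o(2) i(2)]) (simp add: my)
  from DERIV_unique[OF this DERIV_ident]
  have e4: "2 * r^3 * (1 + a * b) * ((1 - b\<^sup>2) * \<gamma> + (1 - a\<^sup>2) * \<delta>) = 1" .
  \<comment> \<open>Multiplicativity of determinants: the Jacobian of \<open>modulus_map\<close> is
    \<open>8 * r^6 * (a + b)\<close> times the first bracket, that of the chart is
    \<open>\<alpha> * \<delta> - \<beta> * \<gamma>\<close>.\<close>
  have "((b - a) * (1 + a * b) * (1 - a * b)) * (8 * r^6 * (a + b) * (\<alpha> * \<delta> - \<beta> * \<gamma>))
      = (4 * r^3 * (b - a) * (b * \<alpha> - a * \<beta>)) * (2 * r^3 * (1 + a * b) * ((1 - b\<^sup>2) * \<gamma> + (1 - a\<^sup>2) * \<delta>))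
      - (4 * r^3 * (b - a) * (b * \<gamma> - a * \<delta>)) * (2 * r^3 * (1 + a * b) * ((1 - b\<^sup>2) * \<alpha> + (1 - a\<^sup>2) * \<beta>))"
    by algebra
  also have "\<dots> = 1" unfolding e1 e2 e3 e4 by simp
  finally show ?thesis by (auto simp: a_def b_def xy)
qed

lemma system_S_iff_modulus_ops:
  assumes p: "p \<in> V" and F: "F holomorphic2_on V"
  shows "system_S F (fst p) (snd p) \<longleftrightarrow>
    modulus_op (\<lambda>s. F (modulus_map s (L2 p)) / (s + L2 p)) (L1 p) = 0 \<and>
    modulus_op (\<lambda>s. F (modulus_map (L1 p) s) / (L1 p + s)) (L2 p) = 0"
  using system_S_pullback_iff[OF open_V F _ sum_nonzero[OF p] jacobian_nonzero[OF p]]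
  by (simp add: map p)

text \<open>After division by the sum of the moduli, \<open>F\<close> is a constant times a function
  of each coordinate, so each separated operator acts on one factor and sees the other as a
  constant.\<close>

lemma product_solution:
  assumes p: "p \<in> N" and N: "open N" "N \<subseteq> V" and F: "F holomorphic2_on V"
    and A: "open A" "L1 p \<in> A" "u holomorphic_on A" "modulus_op u (L1 p) = 0"
    and B: "open B" "L2 p \<in> B" "v holomorphic_on B" "modulus_op v (L2 p) = 0"
    and eq: "\<And>q. q \<in> N \<Longrightarrow> F q = c * (L1 q + L2 q) * u (L1 q) * v (L2 q)"
  shows "system_S F (fst p) (snd p)"
proof -
  have pV: "p \<in> V" using p N by blast
  have "open (chart ` N)" by (rule open_chart_image[OF N])
  moreover have "(L1 p, L2 p) \<in> chart ` N" using p by blast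
  ultimately obtain A' B' where AB: "open A'" "open B'" "L1 p \<in> A'" "L2 p \<in> B'" "A' \<times> B' \<subseteq> chart ` N"
    by (rule open_prod_boxE)
  have G: "F (modulus_map s t) / (s + t) = c * u s * v t" if "s \<in> A'" "t \<in> B'" for s t
  proof -
    have "(s, t) \<in> chart ` N" using AB that by blast
    then obtain q where q: "q \<in> N" "s = L1 q" "t = L2 q" by auto
    then have "q \<in> V" using N by blast
    then show ?thesis
      using q map[of q] sum_nonzero[of q] by (simp add: eq)
  qed
  have "modulus_op (\<lambda>s. F (modulus_map s (L2 p)) / (s + L2 p)) (L1 p)
      = modulus_op (\<lambda>s. (c * v (L2 p)) * u s) (L1 p)"
    by (rule sl_op_cong[OF AB(1) _ AB(3)]) (simp add: G AB(4))
  also have "\<dots> = 0"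
    by (subst sl_op_cmult[OF A(1,3,2)]) (simp add: A(4))
  finally have 1: "modulus_op (\<lambda>s. F (modulus_map s (L2 p)) / (s + L2 p)) (L1 p) = 0" .
  have "modulus_op (\<lambda>s. F (modulus_map (L1 p) s) / (L1 p + s)) (L2 p)
      = modulus_op (\<lambda>s. (c * u (L1 p)) * v s) (L2 p)"
    by (rule sl_op_cong[OF AB(2) _ AB(4)]) (simp add: G AB(3))
  also have "\<dots> = 0"
    by (subst sl_op_cmult[OF B(1,3,2)]) (simp add: B(4))
  finally show ?thesis
    using 1 system_S_iff_modulus_ops[OF pV F] by blast
qed

text \<open>Near \<open>p\<close> the branches \<open>K1\<close> and \<open>K2\<close> are functions \<open>f\<close> of the first and \<open>g\<close> of the second
  coordinate alone.\<close>

definition local_frame :: "(complex \<times> complex \<Rightarrow> complex) \<Rightarrow> (complex \<times> complex \<Rightarrow> complex) \<Rightarrow>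
    complex \<times> complex \<Rightarrow> real \<Rightarrow> (complex \<Rightarrow> complex) \<Rightarrow> (complex \<Rightarrow> complex) \<Rightarrow> bool" where
  "local_frame K1 K2 p r f g \<longleftrightarrow> 0 < r \<and> p \<in> V \<and>
     ball (L1 p) r \<times> ball (L2 p) r \<subseteq> chart ` V \<and>
     f holomorphic_on ball (L1 p) r \<and> g holomorphic_on ball (L2 p) r \<and>
     (\<forall>s\<in>ball (L1 p) r. modulus_op f s = 0) \<and> (\<forall>t\<in>ball (L2 p) r. modulus_op g t = 0) \<and>
     modulus_wronskian (\<lambda>s. ellK (s\<^sup>2)) f (L1 p) \<noteq> 0 \<and>
     modulus_wronskian (\<lambda>s. ellK (1 - s\<^sup>2)) g (L2 p) \<noteq> 0 \<and>
     (\<forall>q\<in>V. L1 q \<in> ball (L1 p) r \<longrightarrow> L2 q \<in> ball (L2 p) r \<longrightarrow> K1 q = f (L1 q) \<and> K2 q = g (L2 q))"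

lemma local_frame_shrink:
  assumes "local_frame K1 K2 p r f g" "0 < r'" "r' \<le> r"
  shows "local_frame K1 K2 p r' f g"
proof -
  have sub: "ball z r' \<subseteq> ball z r" for z :: complex using assms(3) by (rule subset_ball)
  note L = assms(1)[unfolded local_frame_def]
  show ?thesis
    unfolding local_frame_def
  proof (intro conjI)
    show "ball (L1 p) r' \<times> ball (L2 p) r' \<subseteq> chart ` V"
      using L sub by (meson Sigma_mono order_trans)
    show "f holomorphic_on ball (L1 p) r'" "g holomorphic_on ball (L2 p) r'"
      using L sub by (meson holomorphic_on_subset)+
    show "\<forall>s\<in>ball (L1 p) r'. modulus_op f s = 0" "\<forall>t\<in>ball (L2 p) r'. modulus_op g t = 0"
      using L sub by (meson subsetD)+
    show "\<forall>q\<in>V. L1 q \<in> ball (L1 p) r' \<longrightarrow> L2 q \<in> ball (L2 p) r' \<longrightarrow> K1 q = f (L1 q) \<and> K2 q = g (L2 q)"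
      using L sub by (meson subsetD)
  qed (use L assms(2) in simp_all)
qed

text \<open>\<open>branch_on\<close> ties the branches to one-variable germs only on some
  neighbourhood of \<open>p\<close> in \<open>V\<close>. Injectivity of the chart converts this into
  a condition on the coordinates alone.\<close>

lemma local_frame_exists:
  assumes K1: "branch_on V (\<lambda>s. ellK (1 - s\<^sup>2)) L1 K1"
    and K2: "branch_on V (\<lambda>w. ellK (1 - w)) (\<lambda>p. 1 - (L2 p)\<^sup>2) K2"
    and p: "p \<in> V"
  obtains r f g where "local_frame K1 K2 p r f g"
proof -
  obtain \<gamma>1 f where \<gamma>1: "pathstart \<gamma>1 \<in> of_real ` {0<..<1}" "pathfinish \<gamma>1 = L1 p"
      "path_image \<gamma>1 \<subseteq> {s. 0 < norm s \<and> norm s < 1}" "continues_along \<gamma>1 (\<lambda>s. ellK (1 - s\<^sup>2)) f"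
      "\<forall>\<^sub>F q in nhds p. K1 q = f (L1 q)"
    using K1 p unfolding branch_on_def by blast
  obtain \<gamma>2 k where \<gamma>2: "pathstart \<gamma>2 \<in> of_real ` {0<..<1}" "pathfinish \<gamma>2 = 1 - (L2 p)\<^sup>2"
      "path_image \<gamma>2 \<subseteq> {s. 0 < norm s \<and> norm s < 1}" "continues_along \<gamma>2 (\<lambda>w. ellK (1 - w)) k"
      "\<forall>\<^sub>F q in nhds p. K2 q = k (1 - (L2 q)\<^sup>2)"
    using K2 p unfolding branch_on_def by blast
  note f = branch_modulus[OF \<gamma>1(4,1,3), unfolded \<gamma>1(2)]
  note k = branch_param[OF \<gamma>2(4,1,3), unfolded \<gamma>2(2)]
  obtain S1 where S1: "open S1" "L1 p \<in> S1" "f holomorphic_on S1"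
    using continues_along_analytic[OF \<gamma>1(4)] unfolding \<gamma>1(2) analytic_at by blast
  obtain S2 where S2: "open S2" "1 - (L2 p)\<^sup>2 \<in> S2" "k holomorphic_on S2"
    using continues_along_analytic[OF \<gamma>2(4)] unfolding \<gamma>2(2) analytic_at by blast
  obtain T1 where T1: "open T1" "L1 p \<in> T1" "\<And>z. z \<in> T1 \<Longrightarrow> modulus_op f z = 0"
    using f(1) unfolding eventually_nhds by blast
  obtain T2 where T2: "open T2" "1 - (L2 p)\<^sup>2 \<in> T2" "\<And>z. z \<in> T2 \<Longrightarrow> param_op k z = 0"
    using k(1) unfolding eventually_nhds by blast
  obtain N where N: "open N" "p \<in> N"
    "\<And>q. q \<in> N \<Longrightarrow> K1 q = f (L1 q) \<and> K2 q = k (1 - (L2 q)\<^sup>2)"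
    using eventually_conj[OF \<gamma>1(5) \<gamma>2(5)] unfolding eventually_nhds by blast
  \<comment> \<open>\<open>K2\<close> is continued in the parameter \<open>w = 1 - b^2\<close>; the
    substitution turns its germ into a function of the modulus \<open>b\<close>.\<close>
  define g where "g = (\<lambda>z. k (1 - z\<^sup>2))"
  \<comment> \<open>The unit disc is included so that \<open>ellK\<close> is holomorphic on the same
    set and its Wronskian with \<open>k\<close> can be transported.\<close>
  define S where "S = {z. 1 - z\<^sup>2 \<in> S2 \<inter> ball 0 1}"
  define T where "T = {z. 1 - z\<^sup>2 \<in> T2}"
  have S': "open (S2 \<inter> ball 0 1)" "k holomorphic_on S2 \<inter> ball 0 1" "ellK holomorphic_on S2 \<inter> ball 0 1"
    using S2 holomorphic_on_ellK by (auto intro: holomorphic_on_subset)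
  have S: "open S" "L2 p \<in> S" "g holomorphic_on S"
  proof -
    have sq: "S = {z. z\<^sup>2 \<in> {z. 1 - z \<in> S2 \<inter> ball 0 1}}" by (simp add: S_def)
    show "open S"
      unfolding sq by (intro open_vimage_square open_vimage_diff1 S')
    show "L2 p \<in> S" using S2 small(2)[OF p] by (simp add: S_def)
    show "g holomorphic_on S"
      unfolding sq g_def by (intro holomorphic_compose_square[of "\<lambda>m. k (1 - m)"] holomorphic_compose_diff1 S')
  qed
  have T: "open T" "L2 p \<in> T"
  proof -
    have sq: "T = {z. z\<^sup>2 \<in> {z. 1 - z \<in> T2}}" by (simp add: T_def)
    show "open T" unfolding sq by (intro open_vimage_square open_vimage_diff1 T2)
    show "L2 p \<in> T" using T2 by (simp add: T_def)
  qed
  have gop: "modulus_op g z = 0" if "z \<in> S \<inter> T" for z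
  proof -
    have "modulus_op (\<lambda>s. k (1 - s\<^sup>2)) z = 4 * z * param_op k (1 - z\<^sup>2)"
      using that by (intro modulus_op_one_minus_square[OF S'(1,2)]) (simp add: S_def)
    also have "param_op k (1 - z\<^sup>2) = 0" using that by (intro T2(3)) (simp add: T_def)
    finally show ?thesis by (simp add: g_def)
  qed
  have "modulus_wronskian (\<lambda>s. ellK (1 - s\<^sup>2)) (\<lambda>s. k (1 - s\<^sup>2)) (L2 p)
      = - 2 * param_wronskian ellK k (1 - (L2 p)\<^sup>2)"
    using S(2) by (intro modulus_wronskian_one_minus_square[OF S'(1,3,2)]) (simp add: S_def)
  then have gW: "modulus_wronskian (\<lambda>s. ellK (1 - s\<^sup>2)) g (L2 p) \<noteq> 0"
    using k(2) by (simp add: g_def)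
  have O: "open (chart ` (N \<inter> V) \<inter> (S1 \<inter> T1) \<times> (S \<inter> T))"
    by (intro open_Int open_Times open_chart_image S1 T1 S T N open_V) auto
  have "(L1 p, L2 p) \<in> chart ` (N \<inter> V) \<inter> (S1 \<inter> T1) \<times> (S \<inter> T)"
    using N p S1 T1 S T by auto
  with O obtain A B where AB: "open A" "open B" "L1 p \<in> A" "L2 p \<in> B"
      "A \<times> B \<subseteq> chart ` (N \<inter> V) \<inter> (S1 \<inter> T1) \<times> (S \<inter> T)"
    by (rule open_prod_boxE)
  obtain r1 where r1: "r1 > 0" "ball (L1 p) r1 \<subseteq> A" using AB openE by blast
  obtain r2 where r2: "r2 > 0" "ball (L2 p) r2 \<subseteq> B" using AB openE by blast
  define r where "r = min r1 r2"
  have r: "r > 0" using r1 r2 by (simp add: r_def)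
  have rA: "ball (L1 p) r \<subseteq> A" "ball (L2 p) r \<subseteq> B"
    using r1 r2 subset_ball[of r r1 "L1 p"] subset_ball[of r r2 "L2 p"] by (auto simp: r_def)
  have box: "ball (L1 p) r \<times> ball (L2 p) r \<subseteq> chart ` (N \<inter> V)"
      "ball (L1 p) r \<subseteq> S1 \<inter> T1" "ball (L2 p) r \<subseteq> S \<inter> T"
    using AB rA by blast+
  have "local_frame K1 K2 p r f g"
    unfolding local_frame_def
  proof (intro conjI ballI impI)
    show "ball (L1 p) r \<times> ball (L2 p) r \<subseteq> chart ` V" using box(1) by blast
    show "f holomorphic_on ball (L1 p) r" using box(2) by (intro holomorphic_on_subset[OF S1(3)]) blast
    show "g holomorphic_on ball (L2 p) r" using box(3) by (intro holomorphic_on_subset[OF S(3)]) blast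
    show "modulus_op f s = 0" if "s \<in> ball (L1 p) r" for s using that box(2) T1(3) by blast
    show "modulus_op g s = 0" if "s \<in> ball (L2 p) r" for s using that box(3) gop by blast
    fix q assume q: "q \<in> V" "L1 q \<in> ball (L1 p) r" "L2 q \<in> ball (L2 p) r"
    then have "(L1 q, L2 q) \<in> chart ` (N \<inter> V)" using box(1) by blast
    then obtain q' where q': "q' \<in> N" "q' \<in> V" "L1 q' = L1 q" "L2 q' = L2 q" by auto
    \<comment> \<open>A point is recovered from its coordinates by \<open>modulus_map\<close>; hence
      \<open>q\<close> lies in \<open>N\<close>, where the branches agree with their germs.\<close>
    have "q' = q"
      using map[OF q'(2)] map[OF q(1)] unfolding q'(3,4) by (rule trans[OF sym])
    then show "K1 q = f (L1 q)" "K2 q = g (L2 q)" using N(3)[of q] q' by (simp_all add: g_def)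
  qed (use r p f(2) gW in auto)
  then show thesis by (rule that)
qed

end

section \<open>Bases of solutions\<close>

lemma solution_basis_on_4I:
  assumes sol: "P0 \<in> solutions_on V" "P1 \<in> solutions_on V" "P2 \<in> solutions_on V" "P3 \<in> solutions_on V"
    and indep: "\<And>c0 c1 c2 c3. (\<And>p. p \<in> V \<Longrightarrow> c0 * P0 p + c1 * P1 p + c2 * P2 p + c3 * P3 p = 0) \<Longrightarrow>
      c0 = 0 \<and> c1 = 0 \<and> c2 = 0 \<and> c3 = 0"
    and span: "\<And>F. F \<in> solutions_on V \<Longrightarrow>
      \<exists>c0 c1 c2 c3. \<forall>p\<in>V. F p = c0 * P0 p + c1 * P1 p + c2 * P2 p + c3 * P3 p"
  shows "solution_basis_on V [P0, P1, P2, P3]"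
proof -
  have sum: "(\<Sum>i<length [P0, P1, P2, P3]. c i * ([P0, P1, P2, P3] ! i) p) =
      c 0 * P0 p + c 1 * P1 p + c 2 * P2 p + c 3 * P3 p" for c :: "nat \<Rightarrow> complex" and p
    by (simp add: lessThan_Suc eval_nat_numeral)
  show ?thesis
    unfolding solution_basis_on_def sum
  proof (intro conjI allI impI ballI)
    show "set [P0, P1, P2, P3] \<subseteq> solutions_on V" using sol by simp
  next
    fix c :: "nat \<Rightarrow> complex" and i
    assume "\<forall>p\<in>V. c 0 * P0 p + c 1 * P1 p + c 2 * P2 p + c 3 * P3 p = 0"
      and i: "i < length [P0, P1, P2, P3]"
    then have "c 0 = 0 \<and> c 1 = 0 \<and> c 2 = 0 \<and> c 3 = 0" by (intro indep) blast
    moreover have "i = 0 \<or> i = 1 \<or> i = 2 \<or> i = 3" using i by auto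
    ultimately show "c i = 0" by auto
  next
    fix F assume "F \<in> solutions_on V"
    then obtain c0 c1 c2 c3 where "\<forall>p\<in>V. F p = c0 * P0 p + c1 * P1 p + c2 * P2 p + c3 * P3 p"
      using span by blast
    then show "\<exists>c :: nat \<Rightarrow> complex. \<forall>p\<in>V. F p = c 0 * P0 p + c 1 * P1 p + c 2 * P2 p + c 3 * P3 p"
      by (intro exI[of _ "\<lambda>i::nat. if i = 0 then c0 else if i = 1 then c1 else if i = 2 then c2 else c3"]) simp
  qed
qed

text \<open>The constants \<kappa> stand for the numerical prefactors of the periods; rescaling by
  nonzero constants preserves a basis.\<close>

locale modulus_chart_branches = modulus_chart +
  fixes K1 K2 :: "complex \<times> complex \<Rightarrow> complex" and \<kappa>0 \<kappa>1 \<kappa>2 \<kappa>3 :: complex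
  assumes connected_V: "connected V" and V_nonempty: "V \<noteq> {}"
    and K1: "branch_on V (\<lambda>s. ellK (1 - s\<^sup>2)) L1 K1"
    and K2: "branch_on V (\<lambda>w. ellK (1 - w)) (\<lambda>p. 1 - (L2 p)\<^sup>2) K2"
    and \<kappa>: "\<kappa>0 \<noteq> 0" "\<kappa>1 \<noteq> 0" "\<kappa>2 \<noteq> 0" "\<kappa>3 \<noteq> 0"
begin

definition "period0 p = \<kappa>0 * (L1 p + L2 p) * ellK ((L1 p)\<^sup>2) * ellK (1 - (L2 p)\<^sup>2)"
definition "period1 p = \<kappa>1 * (L1 p + L2 p) * K1 p * ellK (1 - (L2 p)\<^sup>2)"
definition "period2 p = \<kappa>2 * (L1 p + L2 p) * ellK ((L1 p)\<^sup>2) * K2 p"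
definition "period3 p = \<kappa>3 * (L1 p + L2 p) * K1 p * K2 p"

lemma frameE:
  assumes "p \<in> V"
  obtains r f g where "local_frame K1 K2 p r f g"
  using local_frame_exists[OF K1 K2 assms] by blast

lemma frame_point:
  assumes "local_frame K1 K2 p r f g" "s \<in> ball (L1 p) r" "t \<in> ball (L2 p) r"
  obtains q where "q \<in> V" "s = L1 q" "t = L2 q" "K1 q = f s" "K2 q = g t" "modulus_map s t = q" "s + t \<noteq> 0"
proof -
  have "(s, t) \<in> chart ` V"
    using assms unfolding local_frame_def by blast
  then obtain q where q: "q \<in> V" "s = L1 q" "t = L2 q" by auto
  moreover have "K1 q = f s" "K2 q = g t"
    using assms q unfolding local_frame_def by blast+
  ultimately show thesis
    using that map[of q] sum_nonzero[of q] by blast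
qed

text \<open>Every point of the box is the image of a point of \<open>V\<close>, so the bounds and
  excluded values known on \<open>V\<close> hold on both discs.\<close>

lemma frame_elliptic:
  assumes fr: "local_frame K1 K2 p r f g"
  shows "(\<lambda>s. ellK (s\<^sup>2)) holomorphic_on ball (L1 p) r"
    and "(\<lambda>t. ellK (1 - t\<^sup>2)) holomorphic_on ball (L2 p) r"
    and "s \<in> ball (L1 p) r \<Longrightarrow> modulus_op (\<lambda>s. ellK (s\<^sup>2)) s = 0"
    and "t \<in> ball (L2 p) r \<Longrightarrow> modulus_op (\<lambda>t. ellK (1 - t\<^sup>2)) t = 0"
proof -
  have c: "L1 p \<in> ball (L1 p) r" "L2 p \<in> ball (L2 p) r"
    using fr by (simp_all add: local_frame_def)
  have s: "norm s < 1" "s \<noteq> 0" if s: "s \<in> ball (L1 p) r" for s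
  proof -
    obtain q where "q \<in> V" "s = L1 q" by (rule frame_point[OF fr s c(2)])
    then show "norm s < 1" "s \<noteq> 0" by (simp_all add: small(1) L1_nonzero)
  qed
  have t: "norm (1 - t\<^sup>2) < 1" "t\<^sup>2 \<noteq> 1" if t: "t \<in> ball (L2 p) r" for t
  proof -
    obtain q where "q \<in> V" "t = L2 q" by (rule frame_point[OF fr c(1) t])
    then show "norm (1 - t\<^sup>2) < 1" "t\<^sup>2 \<noteq> 1" by (simp_all add: small(2) L2_square_neq_1)
  qed
  show "(\<lambda>s. ellK (s\<^sup>2)) holomorphic_on ball (L1 p) r"
    by (rule holomorphic_on_subset[OF holomorphic_ellK_square]) (use s(1) in \<open>simp add: subset_iff\<close>)
  show "(\<lambda>t. ellK (1 - t\<^sup>2)) holomorphic_on ball (L2 p) r"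
    by (rule holomorphic_on_subset[OF holomorphic_ellK_one_minus_square]) (use t(1) in \<open>simp add: subset_iff\<close>)
  show "modulus_op (\<lambda>s. ellK (s\<^sup>2)) s = 0" if "s \<in> ball (L1 p) r"
    by (rule modulus_op_ellK_square[OF s[OF that]])
  show "modulus_op (\<lambda>t. ellK (1 - t\<^sup>2)) t = 0" if "t \<in> ball (L2 p) r"
    by (rule modulus_op_ellK_one_minus_square[OF t[OF that]])
qed

lemma frame_neighbourhood:
  assumes fr: "local_frame K1 K2 p r f g"
  defines "N \<equiv> {q \<in> V. L1 q \<in> ball (L1 p) r \<and> L2 q \<in> ball (L2 p) r}"
  shows "open N" "p \<in> N" "N \<subseteq> V" "q \<in> N \<Longrightarrow> K1 q = f (L1 q) \<and> K2 q = g (L2 q)"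
proof -
  have "open (V \<inter> chart -` (ball (L1 p) r \<times> ball (L2 p) r))"
    using holomorphic2_on_imp_continuous_on[OF hol1] holomorphic2_on_imp_continuous_on[OF hol2]
    by (intro continuous_open_preimage continuous_on_Pair open_V open_Times open_ball)
  also have "V \<inter> chart -` (ball (L1 p) r \<times> ball (L2 p) r) = N" by (auto simp: N_def)
  finally show "open N" .
  show "p \<in> N" using fr by (simp add: N_def local_frame_def)
  show "N \<subseteq> V" by (auto simp: N_def)
  show "K1 q = f (L1 q) \<and> K2 q = g (L2 q)" if "q \<in> N"
    using fr that unfolding local_frame_def N_def by blast
qed

lemma periods_solutions:
  "period0 \<in> solutions_on V" "period1 \<in> solutions_on V" "period2 \<in> solutions_on V" "period3 \<in> solutions_on V"
proof -
  have k: "K1 holomorphic2_on V" "K2 holomorphic2_on V"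
    using K1 K2 by (simp_all add: branch_on_def)
  have o: "open {t::complex. norm (1 - t\<^sup>2) < 1}"
    by (intro open_Collect_less continuous_intros)
  have e: "(\<lambda>p. ellK ((L1 p)\<^sup>2)) holomorphic2_on V" "(\<lambda>p. ellK (1 - (L2 p)\<^sup>2)) holomorphic2_on V"
    using small
    by (auto intro!: holomorphic2_on_compose[OF holomorphic_ellK_square open_ball hol1]
        holomorphic2_on_compose[OF holomorphic_ellK_one_minus_square o hol2])
  have hol: "period0 holomorphic2_on V" "period1 holomorphic2_on V" "period2 holomorphic2_on V" "period3 holomorphic2_on V"
    unfolding period0_def[abs_def] period1_def[abs_def] period2_def[abs_def] period3_def[abs_def]
    by (intro holomorphic2_on_mult holomorphic2_on_add holomorphic2_on_const hol1 hol2 k e)+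
  have "system_S period0 (fst p) (snd p) \<and> system_S period1 (fst p) (snd p) \<and>
      system_S period2 (fst p) (snd p) \<and> system_S period3 (fst p) (snd p)" if p: "p \<in> V" for p
  proof -
    obtain r f g where fr: "local_frame K1 K2 p r f g" using frameE[OF p] .
    note N = frame_neighbourhood[OF fr] and ell = frame_elliptic[OF fr]
    have c: "L1 p \<in> ball (L1 p) r" "L2 p \<in> ball (L2 p) r"
      and f: "f holomorphic_on ball (L1 p) r" "modulus_op f (L1 p) = 0"
      and g: "g holomorphic_on ball (L2 p) r" "modulus_op g (L2 p) = 0"
      using fr by (simp_all add: local_frame_def)
    note sol = product_solution[OF N(2,1,3) _ open_ball c(1) _ _ open_ball c(2)]
    show ?thesis
      by (intro conjI; rule sol[where c = \<kappa>0, OF hol(1) ell(1) ell(3)[OF c(1)] ell(2) ell(4)[OF c(2)]]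
          sol[where c = \<kappa>1, OF hol(2) f ell(2) ell(4)[OF c(2)]] sol[where c = \<kappa>2, OF hol(3) ell(1) ell(3)[OF c(1)] g] sol[where c = \<kappa>3, OF hol(4) f g])
        (use N(4) in \<open>simp_all add: period0_def period1_def period2_def period3_def\<close>)
  qed
  then show "period0 \<in> solutions_on V" "period1 \<in> solutions_on V" "period2 \<in> solutions_on V" "period3 \<in> solutions_on V"
    using hol by (auto simp: solutions_on_def)
qed

text \<open>Comparing two local representations on an overlap requires independence on arbitrarily
  small open sets. On a box inside the chart image of \<open>N\<close> the claim is
  \<open>wronskian_independent2\<close>.\<close>

lemma periods_locally_independent:
  assumes N: "open N" "p \<in> N" "N \<subseteq> V"
    and zero: "\<And>q. q \<in> N \<Longrightarrow> c0 * period0 q + c1 * period1 q + c2 * period2 q + c3 * period3 q = 0"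
  shows "c0 = 0 \<and> c1 = 0 \<and> c2 = 0 \<and> c3 = 0"
proof -
  have p: "p \<in> V" using N by blast
  obtain r0 f g where fr0: "local_frame K1 K2 p r0 f g" using frameE[OF p] .
  have "open (chart ` N)" by (rule open_chart_image[OF N(1,3)])
  moreover have "(L1 p, L2 p) \<in> chart ` N" using N by blast
  ultimately obtain A B where AB: "open A" "open B" "L1 p \<in> A" "L2 p \<in> B" "A \<times> B \<subseteq> chart ` N"
    by (rule open_prod_boxE)
  obtain r1 where r1: "r1 > 0" "ball (L1 p) r1 \<subseteq> A" using AB openE by blast
  obtain r2 where r2: "r2 > 0" "ball (L2 p) r2 \<subseteq> B" using AB openE by blast
  define r where "r = min r0 (min r1 r2)"
  have "r > 0" using fr0 r1 r2 by (simp add: r_def local_frame_def)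
  moreover have "r \<le> r0" unfolding r_def by (rule min.cobounded1)
  ultimately have fr: "local_frame K1 K2 p r f g"
    by (rule local_frame_shrink[OF fr0])
  have sub: "ball (L1 p) r \<subseteq> A" "ball (L2 p) r \<subseteq> B"
    using r1 r2 subset_ball[of r r1 "L1 p"] subset_ball[of r r2 "L2 p"] by (auto simp: r_def)
  note ell = frame_elliptic[OF fr]
  have "c0 * \<kappa>0 = 0 \<and> c1 * \<kappa>1 = 0 \<and> c2 * \<kappa>2 = 0 \<and> c3 * \<kappa>3 = 0"
  proof (rule wronskian_independent2[where A = "ball (L1 p) r" and B = "ball (L2 p) r"])
    show "f holomorphic_on ball (L1 p) r" "g holomorphic_on ball (L2 p) r"
      "modulus_wronskian (\<lambda>s. ellK (s\<^sup>2)) f (L1 p) \<noteq> 0"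
      "modulus_wronskian (\<lambda>s. ellK (1 - s\<^sup>2)) g (L2 p) \<noteq> 0"
      "L1 p \<in> ball (L1 p) r" "L2 p \<in> ball (L2 p) r"
      using fr by (simp_all add: local_frame_def)
    fix s t assume st: "s \<in> ball (L1 p) r" "t \<in> ball (L2 p) r"
    then have "(s, t) \<in> chart ` N" using AB(5) sub by blast
    then obtain q' where q': "q' \<in> N" "s = L1 q'" "t = L2 q'" by auto
    obtain q where q: "q \<in> V" "s = L1 q" "t = L2 q" "K1 q = f s" "K2 q = g t"
      "modulus_map s t = q" "s + t \<noteq> 0"
      using frame_point[OF fr st] .
    have "q' = q" using map[of q'] q' q(6) N(3) by auto
    with q'(1) have "c0 * period0 q + c1 * period1 q + c2 * period2 q + c3 * period3 q = 0" by (intro zero) simp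
    then have "(s + t) * (c0 * \<kappa>0 * (ellK (s\<^sup>2) * ellK (1 - t\<^sup>2)) + c1 * \<kappa>1 * (f s * ellK (1 - t\<^sup>2))
        + c2 * \<kappa>2 * (ellK (s\<^sup>2) * g t) + c3 * \<kappa>3 * (f s * g t)) = 0"
      unfolding period0_def period1_def period2_def period3_def q(2,3)[symmetric] q(4,5) by (simp only: algebra_simps)
    then show "c0 * \<kappa>0 * (ellK (s\<^sup>2) * ellK (1 - t\<^sup>2)) + c1 * \<kappa>1 * (f s * ellK (1 - t\<^sup>2))
        + c2 * \<kappa>2 * (ellK (s\<^sup>2) * g t) + c3 * \<kappa>3 * (f s * g t) = 0"
      using q(7) by simp
  qed (use ell in simp_all)
  then show ?thesis using \<kappa> by simp
qed

text \<open>On a box, \<open>F\<close> divided by the sum of the moduli solves the same equation in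
  each variable separately, so \<open>sl_op_span2\<close> applies.\<close>

lemma periods_locally_span:
  assumes F: "F \<in> solutions_on V" and p: "p \<in> V"
  obtains N c0 c1 c2 c3 where "open N" "p \<in> N" "N \<subseteq> V"
    "\<And>q. q \<in> N \<Longrightarrow> F q = c0 * period0 q + c1 * period1 q + c2 * period2 q + c3 * period3 q"
proof -
  obtain r f g where fr: "local_frame K1 K2 p r f g" using frameE[OF p] .
  have FV: "F holomorphic2_on V" and S: "\<And>q. q \<in> V \<Longrightarrow> system_S F (fst q) (snd q)"
    using F by (auto simp: solutions_on_def)
  let ?A = "ball (L1 p) r" and ?B = "ball (L2 p) r"
  note N = frame_neighbourhood[OF fr] and ell = frame_elliptic[OF fr]
  let ?G = "\<lambda>s t. F (modulus_map s t) / (s + t)"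
  have ops: "modulus_op (\<lambda>s. ?G s t) s = 0 \<and> modulus_op (\<lambda>t. ?G s t) t = 0 \<and>
      (\<lambda>s. ?G s t) field_differentiable at s \<and> (\<lambda>t. ?G s t) field_differentiable at t"
    if st: "s \<in> ?A" "t \<in> ?B" for s t
  proof -
    obtain q where q: "q \<in> V" "s = L1 q" "t = L2 q" "modulus_map s t = q" "s + t \<noteq> 0"
      by (rule frame_point[OF fr st])
    have "(\<lambda>s'. ?G s' t) field_differentiable at s"
      using q by (intro field_differentiable_pullback[OF open_V FV]) auto
    \<comment> \<open>The pullback lemma differentiates in the first argument; the symmetry of
      \<open>modulus_map\<close> moves the second variable there.\<close>
    moreover have "(\<lambda>t'. F (modulus_map t' s) / (t' + s)) field_differentiable at t"
      using q by (intro field_differentiable_pullback[OF open_V FV])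
        (auto simp: modulus_map_commute[of "L2 q"] add.commute)
    then have "(\<lambda>t'. ?G s t') field_differentiable at t"
      by (simp only: modulus_map_commute[of s] add.commute[of s])
    ultimately show ?thesis
      using system_S_iff_modulus_ops[OF q(1) FV] S[OF q(1)] unfolding q(2,3) by blast
  qed
  obtain c0 c1 c2 c3 where c: "\<And>s t. s \<in> ?A \<Longrightarrow> t \<in> ?B \<Longrightarrow>
      ?G s t = c0 * (ellK (s\<^sup>2) * ellK (1 - t\<^sup>2)) + c1 * (f s * ellK (1 - t\<^sup>2))
        + c2 * (ellK (s\<^sup>2) * g t) + c3 * (f s * g t)"
  proof (rule sl_op_span2[where A = ?A and B = ?B and G = ?G and ?f1.0 = "\<lambda>s. ellK (s\<^sup>2)" and ?f2.0 = f
        and ?g1.0 = "\<lambda>t. ellK (1 - t\<^sup>2)" and ?g2.0 = g and p = "\<lambda>s. s * (1 - s\<^sup>2)" and q = "\<lambda>s. s"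
        and a = "L1 p" and b = "L2 p"])
    show "f holomorphic_on ?A" "g holomorphic_on ?B" "L1 p \<in> ?A" "L2 p \<in> ?B"
      "modulus_wronskian (\<lambda>s. ellK (s\<^sup>2)) f (L1 p) \<noteq> 0"
      "modulus_wronskian (\<lambda>s. ellK (1 - s\<^sup>2)) g (L2 p) \<noteq> 0"
      using fr by (simp_all add: local_frame_def)
    show "modulus_op f s = 0" if "s \<in> ?A" for s
      using fr that by (simp add: local_frame_def)
    show "modulus_op g t = 0" if "t \<in> ?B" for t
      using fr that by (simp add: local_frame_def)
    show "(\<lambda>s. ?G s t) holomorphic_on ?A" if "t \<in> ?B" for t
      by (rule holomorphic_onI, rule field_differentiable_at_within) (use ops[OF _ that] in blast)
    show "(\<lambda>t. ?G s t) holomorphic_on ?B" if "s \<in> ?A" for s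
      by (rule holomorphic_onI, rule field_differentiable_at_within) (use ops[OF that] in blast)
    show "(\<lambda>s. s * (1 - s\<^sup>2)) holomorphic_on ?A" "(\<lambda>s. s * (1 - s\<^sup>2)) holomorphic_on ?B"
      by (intro holomorphic_intros)+
  qed (use ops ell in \<open>blast intro: connected_ball\<close>)+
  show thesis
  proof (rule that[OF N(1-3)])
    fix q assume q: "q \<in> {q \<in> V. L1 q \<in> ?A \<and> L2 q \<in> ?B}"
    then have "F q / (L1 q + L2 q) = c0 * (ellK ((L1 q)\<^sup>2) * ellK (1 - (L2 q)\<^sup>2)) + c1 * (K1 q * ellK (1 - (L2 q)\<^sup>2))
        + c2 * (ellK ((L1 q)\<^sup>2) * K2 q) + c3 * (K1 q * K2 q)"
      using c[of "L1 q" "L2 q"] map[of q] N(4)[OF q] by simp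
    then have "F q = (L1 q + L2 q) * (c0 * (ellK ((L1 q)\<^sup>2) * ellK (1 - (L2 q)\<^sup>2)) + c1 * (K1 q * ellK (1 - (L2 q)\<^sup>2))
        + c2 * (ellK ((L1 q)\<^sup>2) * K2 q) + c3 * (K1 q * K2 q))"
      using sum_nonzero[of q] q by (simp add: nonzero_divide_eq_eq mult.commute)
    also have "\<dots> = c0 / \<kappa>0 * period0 q + c1 / \<kappa>1 * period1 q + c2 / \<kappa>2 * period2 q + c3 / \<kappa>3 * period3 q"
      using \<kappa> by (simp add: period0_def period1_def period2_def period3_def algebra_simps)
    finally show "F q = c0 / \<kappa>0 * period0 q + c1 / \<kappa>1 * period1 q + c2 / \<kappa>2 * period2 q + c3 / \<kappa>3 * period3 q" .
  qed
qed

lemma periods_span: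
  assumes F: "F \<in> solutions_on V"
  shows "\<exists>c0 c1 c2 c3. \<forall>p\<in>V. F p = c0 * period0 p + c1 * period1 p + c2 * period2 p + c3 * period3 p"
proof -
  obtain p where p: "p \<in> V" using V_nonempty by blast
  obtain N c0 c1 c2 c3 where N: "open N" "p \<in> N" "N \<subseteq> V"
    and c: "\<And>q. q \<in> N \<Longrightarrow> F q = c0 * period0 q + c1 * period1 q + c2 * period2 q + c3 * period3 q"
    using periods_locally_span[OF F p] by blast
  \<comment> \<open>The coefficients found at \<open>p\<close> are fixed, and \<open>Q x\<close>
    asks whether they still represent \<open>F\<close> near \<open>x\<close>.\<close>
  define Q where "Q x \<longleftrightarrow> (\<exists>M. open M \<and> x \<in> M \<and> M \<subseteq> V \<and>
    (\<forall>q\<in>M. F q = c0 * period0 q + c1 * period1 q + c2 * period2 q + c3 * period3 q))" for x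
  have "Q x" if "x \<in> V" for x
  proof (rule connected_induction_simple[OF connected_V p that])
    show "Q p" using N c unfolding Q_def by blast
    fix a assume "a \<in> V"
    then obtain M d0 d1 d2 d3 where M: "open M" "a \<in> M" "M \<subseteq> V"
      and d: "\<And>q. q \<in> M \<Longrightarrow> F q = d0 * period0 q + d1 * period1 q + d2 * period2 q + d3 * period3 q"
      using periods_locally_span[OF F] by metis
    have "Q y" if x: "x \<in> M" "Q x" and y: "y \<in> M" for x y
    proof -
      obtain M' where M': "open M'" "x \<in> M'" "M' \<subseteq> V"
        "\<And>q. q \<in> M' \<Longrightarrow> F q = c0 * period0 q + c1 * period1 q + c2 * period2 q + c3 * period3 q"
        using x(2) unfolding Q_def by blast
      \<comment> \<open>Two representations of \<open>F\<close> meet on an open set containing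
        \<open>x\<close>, so local independence identifies their coefficients, and the fixed ones
        are valid on all of \<open>M\<close>.\<close>
      have "(c0 - d0) * period0 q + (c1 - d1) * period1 q + (c2 - d2) * period2 q + (c3 - d3) * period3 q = 0"
        if "q \<in> M \<inter> M'" for q
        using d[of q] M'(4)[of q] that by (simp add: algebra_simps)
      then have "c0 - d0 = 0 \<and> c1 - d1 = 0 \<and> c2 - d2 = 0 \<and> c3 - d3 = 0"
        using M M' x(1) by (intro periods_locally_independent[of "M \<inter> M'" x]) auto
      then have eq: "c0 = d0" "c1 = d1" "c2 = d2" "c3 = d3" by simp_all
      show "Q y" unfolding Q_def eq using M y d by blast
    qed
    moreover have "openin (top_of_set V) M" using M open_V by (simp add: openin_open_eq)
    ultimately show "\<exists>T. openin (top_of_set V) T \<and> a \<in> T \<and> (\<forall>x\<in>T. \<forall>y\<in>T. Q x \<longrightarrow> Q y)"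
      using M(2) by blast
  qed
  then show ?thesis unfolding Q_def by blast
qed

lemma periods_basis: "solution_basis_on V [period0, period1, period2, period3]"
proof (rule solution_basis_on_4I[OF periods_solutions])
  fix c0 c1 c2 c3
  assume "\<And>p. p \<in> V \<Longrightarrow> c0 * period0 p + c1 * period1 p + c2 * period2 p + c3 * period3 p = 0"
  moreover obtain p where "p \<in> V" using V_nonempty by blast
  ultimately show "c0 = 0 \<and> c1 = 0 \<and> c2 = 0 \<and> c3 = 0"
    using open_V by (intro periods_locally_independent[of V p]) auto
qed (rule periods_span)

end

theorem theorem3p1:
  fixes U V :: "(complex \<times> complex) set"
    and \<Lambda>\<^sub>1 \<Lambda>\<^sub>2 K\<^sub>1 K\<^sub>2 :: "complex \<times> complex \<Rightarrow> complex"
  assumes U: "open U" "connected U" "(0, 0) \<in> U"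
    and hol: "\<Lambda>\<^sub>1 holomorphic2_on U" "\<Lambda>\<^sub>2 holomorphic2_on U"
    and at_0: "\<Lambda>\<^sub>1 (0, 0) = 0" "\<Lambda>\<^sub>2 (0, 0) = 1"
    and nonzero: "\<And>p. p \<in> U \<Longrightarrow> \<Lambda>\<^sub>1 p + \<Lambda>\<^sub>2 p \<noteq> 0"
    and x_eq: "\<And>x y. (x, y) \<in> U \<Longrightarrow>
      x = 4 * \<Lambda>\<^sub>1 (x, y) * \<Lambda>\<^sub>2 (x, y) / (\<Lambda>\<^sub>1 (x, y) + \<Lambda>\<^sub>2 (x, y))\<^sup>2"
    and y_eq: "\<And>x y. (x, y) \<in> U \<Longrightarrow>
      y = - ((1 - (\<Lambda>\<^sub>1 (x, y))\<^sup>2) * (1 - (\<Lambda>\<^sub>2 (x, y))\<^sup>2)) / (\<Lambda>\<^sub>1 (x, y) + \<Lambda>\<^sub>2 (x, y))\<^sup>2"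
    and small: "\<And>p. p \<in> U \<Longrightarrow> norm ((\<Lambda>\<^sub>1 p)\<^sup>2) < 1"
      "\<And>p. p \<in> U \<Longrightarrow> norm (1 - (\<Lambda>\<^sub>2 p)\<^sup>2) < 1"
    and V: "open V" "V \<noteq> {}" "simply_connected V" "V \<subseteq> U - {(x, y). x * y = 0}"
    \<comment> \<open>the chosen branches of \<open>K (1 - \<Lambda>\<^sub>1\<^sup>2)\<close> and \<open>K (\<Lambda>\<^sub>2\<^sup>2)\<close>\<close>
    and K\<^sub>1: "branch_on V (\<lambda>s. ellK (1 - s\<^sup>2)) \<Lambda>\<^sub>1 K\<^sub>1"
    and K\<^sub>2: "branch_on V (\<lambda>w. ellK (1 - w)) (\<lambda>p. 1 - (\<Lambda>\<^sub>2 p)\<^sup>2) K\<^sub>2"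
  shows "solution_basis_on V
    [\<lambda>p. 4 / (of_real pi)\<^sup>2 * (\<Lambda>\<^sub>1 p + \<Lambda>\<^sub>2 p) * ellK ((\<Lambda>\<^sub>1 p)\<^sup>2) * ellK (1 - (\<Lambda>\<^sub>2 p)\<^sup>2),
     \<lambda>p. 4 * \<i> / (of_real pi)\<^sup>2 * (\<Lambda>\<^sub>1 p + \<Lambda>\<^sub>2 p) * K\<^sub>1 p * ellK (1 - (\<Lambda>\<^sub>2 p)\<^sup>2),
     \<lambda>p. 4 * \<i> / (of_real pi)\<^sup>2 * (\<Lambda>\<^sub>1 p + \<Lambda>\<^sub>2 p) * ellK ((\<Lambda>\<^sub>1 p)\<^sup>2) * K\<^sub>2 p,
     \<lambda>p. 4 * \<i>\<^sup>2 / (of_real pi)\<^sup>2 * (\<Lambda>\<^sub>1 p + \<Lambda>\<^sub>2 p) * K\<^sub>1 p * K\<^sub>2 p]"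
proof -
  have VU: "V \<subseteq> U" using V(4) by blast
  interpret modulus_chart_branches V \<Lambda>\<^sub>1 \<Lambda>\<^sub>2 K\<^sub>1 K\<^sub>2 "4 / (of_real pi)\<^sup>2" "4 * \<i> / (of_real pi)\<^sup>2"
      "4 * \<i> / (of_real pi)\<^sup>2" "4 * \<i>\<^sup>2 / (of_real pi)\<^sup>2"
  proof
    show "\<Lambda>\<^sub>1 holomorphic2_on V" "\<Lambda>\<^sub>2 holomorphic2_on V"
      using hol VU by (auto intro: holomorphic2_on_subset)
    show "connected V" using V(3) by (rule simply_connected_imp_connected)
    fix p assume "p \<in> V"
    then have p: "p \<in> U" "fst p * snd p \<noteq> 0" using V(4) by auto
    show "modulus_map (\<Lambda>\<^sub>1 p) (\<Lambda>\<^sub>2 p) = p"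
    proof (cases p)
      case (Pair x y)
      then have "(x, y) \<in> U" using p(1) by simp
      from x_eq[OF this, symmetric] y_eq[OF this, symmetric] show ?thesis
        by (simp only: modulus_map_def Pair)
    qed
    show "\<Lambda>\<^sub>1 p + \<Lambda>\<^sub>2 p \<noteq> 0" by (rule nonzero[OF p(1)])
    show "fst p \<noteq> 0" "snd p \<noteq> 0" using p(2) by auto
    show "norm (\<Lambda>\<^sub>1 p) < 1" using small(1)[OF p(1)] by (simp only: norm_square_less_one)
    show "norm (1 - (\<Lambda>\<^sub>2 p)\<^sup>2) < 1" by (rule small(2)[OF p(1)])
  qed (use V K\<^sub>1 K\<^sub>2 in auto)
  show ?thesis
    using periods_basis unfolding period0_def[abs_def] period1_def[abs_def] period2_def[abs_def] period3_def[abs_def] .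
qed

end
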